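(* Let $\mathbb{F}$ be a field and let $n,k$ be integers with $k \ge 3$, $n \ge k+2$, $|\mathbb{F}| > k$ and $n+k$ odd. If $\phi, \psi \colon M_{n\,k}(\mathbb{F}) \to M_{n\,k}(\mathbb{F})$ are two maps satisfying $$\det\nolimits_{n\,k}(X + \lambda Y) = \det\nolimits_{n\,k}(\phi(X) + \lambda \psi(Y))\quad\text{for all } X, Y \in M_{n\,k}(\mathbb{F}),\ \lambda \in \mathbb{F},$$ then there exist $A \in M_{n\,n}(\mathbb{F})$ and $B \in M_{k\,k}(\mathbb{F})$ such that $$\det\nolimits_{n\,k}\bigl(A(|i_1,\ldots,i_k]\bigr)\cdot \det(B) = (-1)^{i_1+\ldots+i_k-1-\ldots-k}$$ for all increasing sequences $1 \le i_1 < \ldots < i_k \le n$, and $$\phi(X) \equiv \psi(X) \equiv AXB \pmod{W_{n\,k}}\quad\text{for all } X \in M_{n\,k}(\mathbb{F}).$$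
   Context: $M_{n\,k}(\mathbb{F})$ denotes the space of $n\times k$ matrices over $\mathbb{F}$. For $n\ge k$, the Cullis' determinant $\det_{n\,k}\colon M_{n\,k}(\mathbb{F})\to\mathbb{F}$ is $$\det\nolimits_{n\,k}(X) = \sum_{1\le i_1<\ldots<i_k\le n} (-1)^{i_1+\ldots+i_k-1-\ldots-k}\det\bigl(X_{i_1,\ldots,i_k}\bigr),$$ where $X_{i_1,\ldots,i_k}$ is the $k\times k$ submatrix of $X$ formed by rows $i_1,\ldots,i_k$ and all columns, and $\det$ is the ordinary determinant. For $A\in M_{n\,n}(\mathbb{F})$, $A(|i_1,\ldots,i_k]$ denotes the $n\times k$ submatrix of $A$ formed by all rows and by columns $i_1,\ldots,i_k$. $W_{n\,k}\subseteq M_{n\,k}(\mathbb{F})$ is the $k$-dimensional subspace of matrices all of whose rows are equal. Congruence modulo $W_{n\,k}$ means that the differences lie in $W_{n\,k}$. The maps $\phi,\psi$ are not assumed linear or surjective. *)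

theory Defs
  imports "Jordan_Normal_Form.Determinant" "Jordan_Normal_Form.DL_Submatrix"
begin

text \<open>
  An increasing sequence \<open>i\<^sub>1 < \<dots> < i\<^sub>k\<close> of indices is represented by its set of entries. Matrix
  indices start at \<open>0\<close>, so the one-based sequence \<open>1 \<le> i\<^sub>1 < \<dots> < i\<^sub>k \<le> n\<close> corresponds to the
  set \<open>{i\<^sub>1 - 1, \<dots>, i\<^sub>k - 1} \<subseteq> {..<n}\<close> of cardinality \<open>k\<close>; \<^const>\<open>submatrix\<close> lists the
  selected rows and columns in increasing order.
\<close>

definition index_sets :: "nat \<Rightarrow> nat \<Rightarrow> nat set set" where
  "index_sets n k = {I. I \<subseteq> {..<n} \<and> card I = k}"

text \<open>\<open>(-1)\<close> to the power \<open>i\<^sub>1 + \<dots> + i\<^sub>k - 1 - \<dots> - k\<close>, with one-based \<open>i\<^sub>1, \<dots>, i\<^sub>k\<close>.\<close>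

definition index_sign :: "nat set \<Rightarrow> 'a::field" where
  "index_sign I = (-1) powi ((\<Sum>i\<in>I. int (Suc i)) - (\<Sum>j=1..card I. int j))"

definition cullis_det :: "'a::field mat \<Rightarrow> 'a" where
  "cullis_det X =
    (\<Sum>I\<in>index_sets (dim_row X) (dim_col X). index_sign I * det (submatrix X I UNIV))"

definition equal_rows :: "nat \<Rightarrow> nat \<Rightarrow> 'a mat set" where
  "equal_rows n k = {X \<in> carrier_mat n k. \<forall>i<n. \<forall>j<n. row X i = row X j}"

end

theory Submission
  imports Defs
begin

text \<open>
  On columns, \<open>det\<^sub>n\<^sub>k\<close> is an alternating \<open>k\<close>-form, and for \<open>n + k\<close> odd its radical
  is spanned by the constant vectors. Since \<open>\<bar>F\<bar> > k\<close>, the coefficients of each power of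
  \<open>\<lambda>\<close> in the hypothesis agree. The linear coefficients show that \<open>\<psi>\<close> is linear and bijective
  modulo \<open>W\<^sub>n\<^sub>k\<close> and that \<open>\<phi> \<equiv> \<psi>\<close>. By the quadratic coefficients, \<open>\<psi>\<close> preserves the matrices
  any two columns \<open>v, w\<close> of which are perpendicular, that is, contract the \<open>k\<close>-form to zero. All
  rank one matrices have this property, and outside the kernel of one suitable linear functional
  \<open>u\<close>, a vector is perpendicular only to its own multiples modulo constants (for \<open>k = 3\<close> this
  fails on the kernel, so that rank one matrices alone are not characterised). Hence \<open>\<psi>\<close> maps some
  \<open>v \<otimes> e\<^sub>s\<close> to a rank one matrix off \<open>ker u\<close>; comparing its image with those of the other rank
  one matrices that share a factor with it gives \<open>\<psi> (v \<otimes> e\<^sub>s) \<equiv> A v \<otimes> b\<^sub>s\<close> for all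
  \<open>v\<close> and \<open>s\<close>.
\<close>

text \<open>The maps are not assumed linear or surjective, so the linear coefficients have to supply
  both. At suitable base points they express every coordinate of \<open>z\<close> modulo equal rows
  as a fixed linear combination of the coordinates of \<psi> \<open>z\<close>. This is a left
  inverse of a square matrix, hence a two-sided one, so that the coordinates of \<psi>
  \<open>z\<close> depend linearly on those of \<open>z\<close>. The base points and the functional
  u come from the same computation. Inserting unit vectors at the indices of a set K leaves a form
  of the same kind, whose weight at b is (-1)^b times the signs of b - q for q in K. Neighbouring
  indices outside K have opposite weights and the same position relative to every other index, so
  inserting e_i + e_(i+1) cancels almost all terms and leaves differences of consecutive entries.
  The weight that remains for K = {0, ..., k - 4} is u; parity makes it vanish on constants. When
  images of rank one matrices are compared, each sum with a common factor is again of rank one, so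
  its image has pairwise perpendicular columns. The cross terms then force a combination of image
  columns onto a known line.\<close>

section \<open>An alternating form with weights and order signs\<close>

definition order_sign :: "nat \<Rightarrow> nat \<Rightarrow> 'a::field" where
  "order_sign a b = (if a < b then 1 else if a = b then 0 else - 1)"

text \<open>Unfolded, this sums over index tuples the products of weights and entries, times the
  signs of all later minus earlier indices; tuples with a repetition vanish. Peeling off one
  argument moves the signs of its index into the weight, so inductions run over arbitrary
  \<theta>.\<close>

fun alt_form :: "nat \<Rightarrow> (nat \<Rightarrow> 'a::field) \<Rightarrow> (nat \<Rightarrow> 'a) list \<Rightarrow> 'a" where
  "alt_form n \<theta> [] = 1"
| "alt_form n \<theta> (x # xs) =
    (\<Sum>a<n. \<theta> a * x a * alt_form n (\<lambda>b. \<theta> b * order_sign a b) xs)"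

abbreviation unit_fun :: "nat \<Rightarrow> nat \<Rightarrow> 'a::field" where
  "unit_fun a \<equiv> (\<lambda>i. if i = a then 1 else 0)"

lemma order_sign_simps [simp]:
  "order_sign a a = 0" "a < b \<Longrightarrow> order_sign a b = 1" "b < a \<Longrightarrow> order_sign a b = - 1"
  by (auto simp: order_sign_def)

lemma order_sign_eq_0_iff [simp]: "order_sign a b = (0::'a::field) \<longleftrightarrow> a = b"
  by (auto simp: order_sign_def)

lemma alt_form_cong:
  assumes "\<And>a. a < n \<Longrightarrow> \<theta> a = \<theta>' a" and "list_all2 (\<lambda>x y. \<forall>a<n. x a = y a) xs ys"
  shows "alt_form n \<theta> xs = alt_form n \<theta>' ys"
  using assms(2,1)
proof (induction xs ys arbitrary: \<theta> \<theta>' rule: list_all2_induct)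
  case (Cons x xs y ys)
  have "alt_form n (\<lambda>b. \<theta> b * order_sign a b) xs = alt_form n (\<lambda>b. \<theta>' b * order_sign a b) ys" for a
    by (rule Cons.IH) (simp add: Cons.prems)
  with Cons show ?case by (auto intro!: sum.cong)
qed simp

lemma alt_form_linear:
  "alt_form n \<theta> (ps @ (\<lambda>i. x i + c * y i) # qs) =
    alt_form n \<theta> (ps @ x # qs) + c * alt_form n \<theta> (ps @ y # qs)"
proof (induction ps arbitrary: \<theta>)
  case Nil
  then show ?case by (simp add: algebra_simps sum.distrib sum_distrib_left)
next
  case (Cons p ps)
  then show ?case by (simp add: algebra_simps sum.distrib sum_distrib_left)
qed

lemma alt_form_unit_fun:
  assumes "a < n"
  shows "alt_form n \<theta> (unit_fun a # xs) = \<theta> a * alt_form n (\<lambda>b. \<theta> b * order_sign a b) xs"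
proof -
  have "alt_form n \<theta> (unit_fun a # xs) =
      (\<Sum>b<n. if b = a then \<theta> a * alt_form n (\<lambda>b. \<theta> b * order_sign a b) xs else 0)"
    unfolding alt_form.simps by (rule sum.cong) auto
  with assms show ?thesis by simp
qed

text \<open>The scalar collects the weights met while K is absorbed. It is nonzero because in a
  distinct list no entry has had its weight set to zero by an earlier one.\<close>

lemma alt_form_unit_funs:
  assumes "distinct K" and "set K \<subseteq> {..<n}" and "\<And>q. q \<in> set K \<Longrightarrow> \<theta> q \<noteq> 0"
  shows "\<exists>c\<noteq>0. \<forall>xs. alt_form n \<theta> (map unit_fun K @ xs) =
    c * alt_form n (\<lambda>b. \<theta> b * (\<Prod>q\<in>set K. order_sign q b)) xs"
  using assms
proof (induction K arbitrary: \<theta>)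
  case Nil
  show ?case by (rule exI[of _ 1]) simp
next
  case (Cons q K)
  have "\<exists>c\<noteq>0. \<forall>xs. alt_form n (\<lambda>b. \<theta> b * order_sign q b) (map unit_fun K @ xs) =
      c * alt_form n (\<lambda>b. \<theta> b * order_sign q b * (\<Prod>q\<in>set K. order_sign q b)) xs"
    using Cons.prems by (intro Cons.IH) auto
  then obtain c where c: "c \<noteq> 0"
    "\<And>xs. alt_form n (\<lambda>b. \<theta> b * order_sign q b) (map unit_fun K @ xs) =
      c * alt_form n (\<lambda>b. \<theta> b * order_sign q b * (\<Prod>q\<in>set K. order_sign q b)) xs"
    by blast
  have "alt_form n \<theta> (map unit_fun (q # K) @ xs) = (\<theta> q * c) *
      alt_form n (\<lambda>b. \<theta> b * (\<Prod>q\<in>set (q # K). order_sign q b)) xs" for xs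
    using Cons.prems alt_form_unit_fun[of q n \<theta> "map unit_fun K @ xs"] c(2)
    by (simp add: mult.assoc)
  with c(1) Cons.prems show ?case by (intro exI[of _ "\<theta> q * c"]) auto
qed

text \<open>On K the summand is zero; at any other a it is \<open>(- 1) ^ card K\<close> times the
  sign given by the number of indices below a outside K. So this is an alternating sum with n - card
  K terms.\<close>

lemma sum_order_sign:
  assumes "K \<subseteq> {..<n}"
  shows "(\<Sum>a<n. (- 1) ^ a * (\<Prod>q\<in>K. order_sign q a)) =
    (if even (n + card K) then 0 else (- 1 :: 'a::field) ^ card K)"
  using assms
proof (induction n arbitrary: K)
  case 0
  then show ?case by simp
next
  case (Suc n)
  show ?case
  proof (cases "n \<in> K")
    case True
    define L where "L = K - {n}"
    have K: "K = insert n L" and L: "L \<subseteq> {..<n}" "n \<notin> L" "finite L"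
      using True Suc.prems finite_subset[OF Suc.prems] by (auto simp: L_def)
    have "(\<Sum>a<Suc n. (- 1) ^ a * (\<Prod>q\<in>K. order_sign q a)) =
        (\<Sum>a<n. - ((- 1) ^ a * (\<Prod>q\<in>L. order_sign q a :: 'a)))"
      using L by (simp add: K)
    also have "\<dots> = - (if even (n + card L) then 0 else (- 1) ^ card L)"
      by (simp only: sum_negf Suc.IH[OF L(1)])
    finally show ?thesis using L by (simp add: K)
  next
    case False
    with Suc.prems have K: "K \<subseteq> {..<n}" by (auto simp: less_Suc_eq)
    have "(\<Prod>q\<in>K. order_sign q n) = (1::'a)" using K by (intro prod.neutral) auto
    then show ?thesis using Suc.IH[OF K] by (auto simp: minus_one_power_iff)
  qed
qed

text \<open>Each index chosen for an entry of \<open>xs\<close> joins K. When only the constant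
  vector is left, an alternating sum with an even number of terms remains.\<close>

lemma alt_form_1:
  assumes "K \<subseteq> {..<n}" and "odd (n + (card K + length xs + 1))"
  shows "alt_form n (\<lambda>b. (- 1) ^ b * (\<Prod>q\<in>K. order_sign q b)) (xs @ [\<lambda>_. 1]) = (0::'a::field)"
  using assms
proof (induction xs arbitrary: K)
  case Nil
  then show ?case by (simp add: sum_order_sign)
next
  case (Cons x xs)
  have "(- 1) ^ a * (\<Prod>q\<in>K. order_sign q a) * x a *
      alt_form n (\<lambda>b. (- 1) ^ b * (\<Prod>q\<in>K. order_sign q b) * order_sign a b) (xs @ [\<lambda>_. 1]) = (0::'a)"
    if "a < n" for a
  proof (cases "a \<in> K")
    case True
    then have "(\<Prod>q\<in>K. order_sign q a) = (0::'a)"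
      using finite_subset[OF Cons.prems(1)] by (intro prod_zero) auto
    then show ?thesis by simp
  next
    case False
    have fin: "finite K" using Cons.prems(1) finite_subset by blast
    have "alt_form n (\<lambda>b. (- 1) ^ b * (\<Prod>q\<in>insert a K. order_sign q b)) (xs @ [\<lambda>_. 1]) = (0::'a)"
      using False fin Cons.prems that by (intro Cons.IH) auto
    with False fin show ?thesis by (simp add: mult_ac)
  qed
  then show ?case by (simp add: sum.neutral)
qed

context
  fixes n i :: nat and \<theta> :: "nat \<Rightarrow> 'a::field"
  assumes i: "Suc i < n" and sq: "\<theta> i * \<theta> i = 1" and Suc: "\<theta> (Suc i) = - \<theta> i"
begin

text \<open>An index b other than i and \<open>Suc i\<close> has the same order sign against both,
  while their weights are opposite, so its terms cancel.\<close>

lemma alt_form_pair_1: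
  "alt_form n \<theta> [\<lambda>j. unit_fun i j + unit_fun (Suc i) j, y] = y i - y (Suc i)"
proof -
  have "alt_form n \<theta> [\<lambda>j. unit_fun i j + 1 * unit_fun (Suc i) j, y] =
      alt_form n \<theta> [unit_fun i, y] + 1 * alt_form n \<theta> [unit_fun (Suc i), y]"
    using alt_form_linear[of n \<theta> "[]" "unit_fun i" 1 "unit_fun (Suc i)" "[y]"] by simp
  also have "alt_form n \<theta> [unit_fun i, y] = \<theta> i * (\<Sum>b<n. \<theta> b * order_sign i b * y b)"
    using alt_form_unit_fun[of i n \<theta> "[y]"] i by simp
  also have "alt_form n \<theta> [unit_fun (Suc i), y] = - \<theta> i * (\<Sum>b<n. \<theta> b * order_sign (Suc i) b * y b)"
    using alt_form_unit_fun[of "Suc i" n \<theta> "[y]"] i Suc by simp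
  also have "\<theta> i * (\<Sum>b<n. \<theta> b * order_sign i b * y b) +
      1 * (- \<theta> i * (\<Sum>b<n. \<theta> b * order_sign (Suc i) b * y b)) =
      \<theta> i * (\<Sum>b<n. \<theta> b * (order_sign i b - order_sign (Suc i) b) * y b)"
    by (simp add: algebra_simps sum_subtractf)
  also have "(\<Sum>b<n. \<theta> b * (order_sign i b - order_sign (Suc i) b) * y b) =
      (\<Sum>b<n. (if b = i then \<theta> i * y i else 0) + (if b = Suc i then \<theta> (Suc i) * y (Suc i) else 0))"
    by (intro sum.cong) (auto simp: order_sign_def)
  also have "\<dots> = \<theta> i * y i + \<theta> (Suc i) * y (Suc i)"
    using i by (simp add: sum.distrib)
  also have "\<theta> i * \<dots> = (\<theta> i * \<theta> i) * (y i - y (Suc i))"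
    unfolding Suc by (simp add: algebra_simps)
  finally show ?thesis by (simp add: sq)
qed

text \<open>The cancellation now leaves only pairs (b, c) with exactly one index in {i,
  \<open>Suc i\<close>}: with both outside, the two sign products agree; with both inside, some
  order sign is zero.\<close>

lemma alt_form_pair_2:
  "alt_form n \<theta> [\<lambda>j. unit_fun i j + unit_fun (Suc i) j, v, w] =
    (v i - v (Suc i)) * (\<Sum>c<n. \<theta> c * w c) - (w i - w (Suc i)) * (\<Sum>c<n. \<theta> c * v c)"
proof -
  let ?s = "order_sign :: nat \<Rightarrow> nat \<Rightarrow> 'a"
  define a where "a y = (\<Sum>c\<in>{..<n} - {i, Suc i}. \<theta> c * y c)" for y :: "nat \<Rightarrow> 'a"
  \<comment> \<open>Replacing \<open>a\<close> by the full sum changes both products of the result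
    by the same amount, which cancels in their difference.\<close>
  have full: "(\<Sum>c<n. \<theta> c * y c) = \<theta> i * (y i - y (Suc i)) + a y" for y
  proof -
    have "(\<Sum>c<n. \<theta> c * y c) = (\<Sum>c\<in>{i, Suc i}. \<theta> c * y c) + a y"
      unfolding a_def using i by (subst sum.subset_diff[of "{i, Suc i}"]) auto
    then show ?thesis by (simp add: Suc algebra_simps)
  qed
  define T where "T b c = \<theta> b * \<theta> c * v b * w c * ?s b c *
    (?s i b * ?s i c - ?s (Suc i) b * ?s (Suc i) c)" for b c
  have "alt_form n \<theta> [\<lambda>j. unit_fun i j + 1 * unit_fun (Suc i) j, v, w] =
      alt_form n \<theta> [unit_fun i, v, w] + 1 * alt_form n \<theta> [unit_fun (Suc i), v, w]"
    using alt_form_linear[of n \<theta> "[]" "unit_fun i" 1 "unit_fun (Suc i)" "[v, w]"] by simp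
  also have "\<dots> = \<theta> i * (\<Sum>b<n. \<Sum>c<n. T b c)"
    using alt_form_unit_fun[of i n \<theta> "[v, w]"] alt_form_unit_fun[of "Suc i" n \<theta> "[v, w]"] i Suc
    by (simp add: T_def right_diff_distrib sum_subtractf sum_distrib_left mult_ac sum_negf)
  also have "(\<Sum>b<n. \<Sum>c<n. T b c) =
      (\<Sum>b\<in>{i, Suc i}. \<Sum>c<n. T b c) + (\<Sum>b\<in>{..<n} - {i, Suc i}. \<Sum>c<n. T b c)"
    using i by (subst sum.subset_diff[of "{i, Suc i}"]) auto
  also have "(\<Sum>b\<in>{..<n} - {i, Suc i}. \<Sum>c<n. T b c) =
      (\<Sum>b\<in>{..<n} - {i, Suc i}. \<theta> b * v b * (- \<theta> i * (w i - w (Suc i))))"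
  proof (intro sum.cong refl)
    fix b assume b: "b \<in> {..<n} - {i, Suc i}"
    have "(\<Sum>c<n. T b c) = (\<Sum>c\<in>{i, Suc i}. T b c) + (\<Sum>c\<in>{..<n} - {i, Suc i}. T b c)"
      using i by (subst sum.subset_diff[of "{i, Suc i}"]) auto
    also have "(\<Sum>c\<in>{..<n} - {i, Suc i}. T b c) = 0"
      using b by (intro sum.neutral) (auto simp: T_def order_sign_def)
    finally show "(\<Sum>c<n. T b c) = \<theta> b * v b * (- \<theta> i * (w i - w (Suc i)))"
      using b Suc by (auto simp: T_def order_sign_def algebra_simps)
  qed
  also have "\<dots> = - \<theta> i * (w i - w (Suc i)) * a v"
    by (simp add: a_def sum_distrib_left mult_ac)
  also have "(\<Sum>b\<in>{i, Suc i}. \<Sum>c<n. T b c) = \<theta> i * (v i - v (Suc i)) * a w"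
  proof -
    have "(\<Sum>c<n. T b c) = \<theta> b * v b * a w" if b: "b \<in> {i, Suc i}" for b
    proof -
      have "(\<Sum>c<n. T b c) = (\<Sum>c\<in>{i, Suc i}. T b c) + (\<Sum>c\<in>{..<n} - {i, Suc i}. T b c)"
        using i by (subst sum.subset_diff[of "{i, Suc i}"]) auto
      also have "(\<Sum>c\<in>{i, Suc i}. T b c) = 0"
        using b by (auto simp: T_def order_sign_def)
      also have "(\<Sum>c\<in>{..<n} - {i, Suc i}. T b c) =
          (\<Sum>c\<in>{..<n} - {i, Suc i}. \<theta> b * v b * (\<theta> c * w c))"
        using b by (intro sum.cong) (auto simp: T_def order_sign_def)
      finally show ?thesis by (simp add: a_def sum_distrib_left)
    qed
    then show ?thesis by (simp add: Suc algebra_simps)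
  qed
  also have "\<theta> i * (\<theta> i * (v i - v (Suc i)) * a w + - \<theta> i * (w i - w (Suc i)) * a v) =
      (\<theta> i * \<theta> i) * ((v i - v (Suc i)) * a w - (w i - w (Suc i)) * a v)"
    by (simp add: algebra_simps)
  finally show ?thesis by (simp add: sq full) (simp add: algebra_simps)
qed

end

section \<open>The form as a signed sum of maximal minors\<close>

lemma finite_index_sets [simp]: "finite (index_sets n k)"
  by (rule finite_subset[of _ "Pow {..<n}"]) (auto simp: index_sets_def)

lemma pick_eqI: "a \<in> I \<Longrightarrow> card {b \<in> I. b < a} = p \<Longrightarrow> pick I p = a"
  using pick_card_in_set by blast

text \<open>This is the renumbering of rows in \<open>mat_delete\<close>: positions from p on move
  up by one.\<close>

lemma pick_remove:
  assumes "finite I" and p: "p < card I" and q: "Suc q < card I"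
  shows "pick (I - {pick I p}) q = pick I (if q < p then q else Suc q)"
proof -
  define r where "r = (if q < p then q else Suc q)"
  have r: "r < card I" "r \<noteq> p" using p q by (auto simp: r_def)
  have pI: "pick I p \<in> I" and rI: "pick I r \<in> I" using p r by (auto intro: pick_in_set_le)
  have card_r: "card {b \<in> I. b < pick I r} = r" using r by (intro card_pick_le)
  have less_iff: "pick I p < pick I r \<longleftrightarrow> p < r"
    using pick_mono_le[of r I p] pick_mono_le[of p I r] p r by (metis linorder_neqE_nat not_less_iff_gr_or_eq)
  have "card {b \<in> I - {pick I p}. b < pick I r} = q"
  proof (cases "q < p")
    case True
    then have "\<not> pick I p < pick I r" unfolding less_iff by (simp add: r_def)
    then have "{b \<in> I - {pick I p}. b < pick I r} = {b \<in> I. b < pick I r}" by auto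
    with card_r True show ?thesis by (simp add: r_def)
  next
    case False
    then have "pick I p < pick I r" unfolding less_iff by (simp add: r_def)
    then have "{b \<in> I. b < pick I r} = insert (pick I p) {b \<in> I - {pick I p}. b < pick I r}"
      using pI by auto
    with card_r False assms(1) show ?thesis by (simp add: r_def)
  qed
  moreover have "pick I r \<in> I - {pick I p}"
    using rI less_iff r pick_mono_le[of p I r] p by (metis Diff_iff linorder_neqE_nat nat_less_le singletonD)
  ultimately show ?thesis unfolding r_def[symmetric] by (intro pick_eqI)
qed

lemma prod_order_sign:
  assumes "finite J" and "a \<notin> J"
  shows "(\<Prod>b\<in>J. order_sign a b) = (- 1 :: 'a::field) ^ card {b \<in> J. b < a}"
proof -
  have "(\<Prod>b\<in>J. order_sign a b) = (\<Prod>b\<in>J. if b < a then - 1 else (1::'a))"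
    using assms by (intro prod.cong) (auto simp: order_sign_def)
  also have "\<dots> = (\<Prod>b\<in>{b \<in> J. b < a}. - 1)"
    using prod.inter_filter[OF assms(1), of "\<lambda>_. - 1 :: 'a" "\<lambda>b. b < a"] by simp
  finally show ?thesis by simp
qed

text \<open>Laplace expansion along the first column, with rows named by the elements of I instead
  of their positions; the position of a is the number of smaller elements.\<close>

lemma det_pick_expand:
  fixes x :: "nat \<Rightarrow> 'a::field"
  assumes "finite I" and card: "card I = Suc (length xs)"
  shows "det (mat (Suc (length xs)) (Suc (length xs)) (\<lambda>(p, t). ((x # xs) ! t) (pick I p))) =
    (\<Sum>a\<in>I. x a * (- 1) ^ card {b \<in> I. b < a} *
      det (mat (length xs) (length xs) (\<lambda>(p, t). (xs ! t) (pick (I - {a}) p))))"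
    (is "det ?A = _")
proof -
  let ?k = "length xs"
  let ?D = "\<lambda>J. det (mat ?k ?k (\<lambda>(p, t). (xs ! t) (pick J p)))"
  have "det ?A = (\<Sum>p<Suc ?k. ?A $$ (p, 0) * cofactor ?A p 0)"
    by (intro laplace_expansion_column) auto
  also have "\<dots> = (\<Sum>p<Suc ?k. x (pick I p) * (- 1) ^ p * ?D (I - {pick I p}))"
  proof (intro sum.cong refl)
    fix p assume p: "p \<in> {..<Suc ?k}"
    have "mat_delete ?A p 0 = mat ?k ?k (\<lambda>(q, t). (xs ! t) (pick (I - {pick I p}) q))"
      using p assms pick_remove[OF assms(1), of p] unfolding mat_delete_def by (intro eq_matI) auto
    with p show "?A $$ (p, 0) * cofactor ?A p 0 = x (pick I p) * (- 1) ^ p * ?D (I - {pick I p})"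
      by (simp add: cofactor_def)
  qed
  also have "\<dots> = (\<Sum>a\<in>I. x a * (- 1) ^ card {b \<in> I. b < a} * ?D (I - {a}))"
  proof (rule sum.reindex_bij_witness[of _ "\<lambda>a. card {b \<in> I. b < a}" "pick I"])
    fix a assume "a \<in> I"
    then show "pick I (card {b \<in> I. b < a}) = a" by (rule pick_card_in_set)
    have "{b \<in> I. b < a} \<subset> I" using \<open>a \<in> I\<close> by auto
    then have "card {b \<in> I. b < a} < card I" by (intro psubset_card_mono assms)
    with card show "card {b \<in> I. b < a} \<in> {..<Suc ?k}" by simp
  next
    fix p assume "p \<in> {..<Suc ?k}"
    with card have p: "p < card I" by simp
    show "pick I p \<in> I" using p by (rule pick_in_set_le)
    show "card {b \<in> I. b < pick I p} = p" using p by (rule card_pick_le)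
    then show "x (pick I p) * (- 1) ^ card {b \<in> I. b < pick I p} * ?D (I - {pick I p}) =
        x (pick I p) * (- 1) ^ p * ?D (I - {pick I p})" by simp
  qed
  finally show ?thesis .
qed

text \<open>A first index a together with the set J of the others is a set I with a marked element.
  The order signs of a against J multiply to the cofactor sign of a in I.\<close>

lemma alt_form_eq_sum_det:
  "alt_form n \<theta> xs = (\<Sum>I\<in>index_sets n (length xs). (\<Prod>i\<in>I. \<theta> i) *
    det (mat (length xs) (length xs) (\<lambda>(p, t). (xs ! t) (pick I p))))"
proof (induction xs arbitrary: \<theta>)
  case Nil
  have "index_sets n 0 = {{}}" using finite_subset[of _ "{..<n}"] by (auto simp: index_sets_def)
  then show ?case by simp
next
  case (Cons x xs)
  let ?k = "length xs"
  let ?D = "\<lambda>J. det (mat ?k ?k (\<lambda>(p, t). (xs ! t) (pick J p)))"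
  let ?f = "\<lambda>a J. \<theta> a * x a * ((\<Prod>i\<in>J. \<theta> i) * (- 1) ^ card {b \<in> J. b < a} * ?D J)"
  have fin: "finite J" if "J \<in> index_sets n k'" for J k'
    using that finite_subset by (auto simp: index_sets_def)
  have "alt_form n \<theta> (x # xs) = (\<Sum>a<n. \<Sum>J\<in>{J \<in> index_sets n ?k. a \<notin> J}. ?f a J)"
  proof (simp only: alt_form.simps, intro sum.cong refl)
    fix a
    have "alt_form n (\<lambda>b. \<theta> b * order_sign a b) xs =
        (\<Sum>J\<in>index_sets n ?k. (\<Prod>i\<in>J. \<theta> i * order_sign a i) * ?D J)"
      by (rule Cons.IH)
    also have "\<dots> = (\<Sum>J\<in>{J \<in> index_sets n ?k. a \<notin> J}. (\<Prod>i\<in>J. \<theta> i * order_sign a i) * ?D J)"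
      using fin by (intro sum.mono_neutral_right) (auto simp: prod.distrib intro!: prod_zero)
    also have "\<dots> = (\<Sum>J\<in>{J \<in> index_sets n ?k. a \<notin> J}.
        (\<Prod>i\<in>J. \<theta> i) * (- 1) ^ card {b \<in> J. b < a} * ?D J)"
      using fin by (intro sum.cong) (auto simp: prod.distrib prod_order_sign)
    finally show "\<theta> a * x a * alt_form n (\<lambda>b. \<theta> b * order_sign a b) xs =
        (\<Sum>J\<in>{J \<in> index_sets n ?k. a \<notin> J}. ?f a J)"
      by (simp add: sum_distrib_left)
  qed
  also have "\<dots> = (\<Sum>(a, J)\<in>(SIGMA a:{..<n}. {J \<in> index_sets n ?k. a \<notin> J}). ?f a J)"
    by (subst sum.Sigma) auto
  also have "\<dots> = (\<Sum>(I, a)\<in>(SIGMA I:index_sets n (Suc ?k). I). (\<Prod>i\<in>I. \<theta> i) *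
      (x a * (- 1) ^ card {b \<in> I. b < a} * ?D (I - {a})))"
  proof (rule sum.reindex_bij_witness[of _ "\<lambda>(I, a). (a, I - {a})" "\<lambda>(a, J). (insert a J, a)"])
    fix p assume "p \<in> (SIGMA a:{..<n}. {J \<in> index_sets n ?k. a \<notin> J})"
    then obtain a J where p: "p = (a, J)" "a < n" "J \<in> index_sets n ?k" "a \<notin> J" by auto
    have J: "finite J" "J \<subseteq> {..<n}" "card J = ?k"
      using p(3) fin[OF p(3)] by (simp_all add: index_sets_def)
    show "(case case p of (a, J) \<Rightarrow> (insert a J, a) of (I, a) \<Rightarrow> (a, I - {a})) = p"
      using p(1,4) by simp
    show "(case p of (a, J) \<Rightarrow> (insert a J, a)) \<in> (SIGMA I:index_sets n (Suc ?k). I)"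
      using p(1,2,4) J by (simp add: index_sets_def)
    have "{b. (b = a \<or> b \<in> J) \<and> b < a} = {b \<in> J. b < a}" by auto
    with p J(1) show "(case case p of (a, J) \<Rightarrow> (insert a J, a) of (I, a) \<Rightarrow>
        (\<Prod>i\<in>I. \<theta> i) * (x a * (- 1) ^ card {b \<in> I. b < a} * ?D (I - {a}))) =
        (case p of (a, J) \<Rightarrow> ?f a J)"
      by (simp add: mult_ac)
  next
    fix q assume "q \<in> (SIGMA I:index_sets n (Suc ?k). I)"
    then obtain I a where q: "q = (I, a)" "I \<in> index_sets n (Suc ?k)" "a \<in> I" by auto
    have I: "finite I" "I \<subseteq> {..<n}" "card I = Suc ?k"
      using q(2) fin[OF q(2)] by (simp_all add: index_sets_def)
    show "(case case q of (I, a) \<Rightarrow> (a, I - {a}) of (a, J) \<Rightarrow> (insert a J, a)) = q"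
      using q(1,3) by auto
    show "(case q of (I, a) \<Rightarrow> (a, I - {a})) \<in> (SIGMA a:{..<n}. {J \<in> index_sets n ?k. a \<notin> J})"
      using q(1,3) I by (auto simp: index_sets_def)
  qed
  also have "\<dots> = (\<Sum>I\<in>index_sets n (Suc ?k). \<Sum>a\<in>I. (\<Prod>i\<in>I. \<theta> i) *
      (x a * (- 1) ^ card {b \<in> I. b < a} * ?D (I - {a})))"
    by (rule sum.Sigma[symmetric]) (simp, use fin in blast)
  also have "\<dots> = (\<Sum>I\<in>index_sets n (Suc ?k). (\<Prod>i\<in>I. \<theta> i) *
      det (mat (Suc ?k) (Suc ?k) (\<lambda>(p, t). ((x # xs) ! t) (pick I p))))"
  proof (intro sum.cong refl)
    fix I assume "I \<in> index_sets n (Suc ?k)"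
    then have "finite I" and "card I = Suc ?k" by (rule fin, simp add: index_sets_def)
    from det_pick_expand[OF this, of x] show "(\<Sum>a\<in>I. (\<Prod>i\<in>I. \<theta> i) *
        (x a * (- 1) ^ card {b \<in> I. b < a} * ?D (I - {a}))) = (\<Prod>i\<in>I. \<theta> i) *
        det (mat (Suc ?k) (Suc ?k) (\<lambda>(p, t). ((x # xs) ! t) (pick I p)))"
      by (simp add: sum_distrib_left)
  qed
  finally show ?case by simp
qed

text \<open>Passing from one-based to zero-based indices changes both sums in the exponent by
  \<open>card I\<close>, so only the constant sign of 0 + ... + (\<open>card I\<close> - 1)
  separates the two sides.\<close>

lemma prod_neg_one_eq_index_sign:
  assumes "finite I"
  shows "(\<Prod>i\<in>I. (- 1) ^ i) = (- 1) ^ (\<Sum>j<card I. j) * (index_sign I :: 'a::field)"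
proof -
  have "(\<Sum>i\<in>I. int (Suc i)) = int (\<Sum>i\<in>I. i) + int (card I)"
    by (simp add: sum.distrib)
  moreover have "(\<Sum>j=1..m. int j) = int (\<Sum>j<m. j) + int m" for m by (induction m) auto
  ultimately have "index_sign I = (- 1 :: 'a) powi (int (\<Sum>i\<in>I. i) - int (\<Sum>j<card I. j))"
    by (simp add: index_sign_def)
  also have "\<dots> = (- 1) ^ (\<Sum>i\<in>I. i) / (- 1) ^ (\<Sum>j<card I. j)"
    by (simp add: power_int_diff del: of_nat_sum)
  finally show ?thesis by (simp add: power_sum)
qed

section \<open>The Cullis determinant as a form in k columns\<close>

definition col_fun :: "'a mat \<Rightarrow> nat \<Rightarrow> nat \<Rightarrow> 'a" where
  "col_fun X t i = X $$ (i, t)"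

locale cullis_form =
  fixes n k :: nat
  assumes k_ge: "3 \<le> k" and n_ge: "k + 2 \<le> n" and parity: "odd (n + k)"
begin

definition \<omega> :: "(nat \<Rightarrow> nat \<Rightarrow> 'a::field) \<Rightarrow> 'a" where
  "\<omega> x = alt_form n (\<lambda>a. (- 1) ^ a) (map x [0..<k])"

lemma \<omega>_eq_sum_det:
  "\<omega> x = (\<Sum>I\<in>index_sets n k. (\<Prod>i\<in>I. (- 1) ^ i) * det (mat k k (\<lambda>(p, t). x t (pick I p))))"
proof -
  have "mat k k (\<lambda>(p, t). (map x [0..<k] ! t) (pick I p)) = mat k k (\<lambda>(p, t). x t (pick I p))" for I
    by (intro eq_matI) auto
  then show ?thesis by (simp add: \<omega>_def alt_form_eq_sum_det)
qed

lemma submatrix_rows: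
  assumes "X \<in> carrier_mat n k" and "I \<in> index_sets n k"
  shows "submatrix X I UNIV = mat k k (\<lambda>(p, t). X $$ (pick I p, t))"
proof -
  have "{i. i < n \<and> i \<in> I} = I" using assms by (auto simp: index_sets_def)
  then show ?thesis using assms
    by (intro eq_matI) (auto simp: submatrix_def index_sets_def pick_UNIV)
qed

lemma cullis_det_eq_\<omega>:
  assumes "X \<in> carrier_mat n k"
  shows "cullis_det X = (- 1) ^ (\<Sum>j<k. j) * \<omega> (col_fun X)"
proof -
  have "index_sign I = (- 1 :: 'a) ^ (\<Sum>j<k. j) * (\<Prod>i\<in>I. (- 1) ^ i)" if "I \<in> index_sets n k" for I
    using that prod_neg_one_eq_index_sign[of I, where 'a = 'a] finite_subset[of I "{..<n}"]
    by (auto simp: index_sets_def minus_one_power_iff)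
  with assms show ?thesis
    by (simp add: cullis_det_def \<omega>_eq_sum_det submatrix_rows col_fun_def sum_distrib_left mult_ac)
qed

lemma \<omega>_cong:
  assumes "\<And>t i. t < k \<Longrightarrow> i < n \<Longrightarrow> x t i = y t i"
  shows "\<omega> x = \<omega> y"
  unfolding \<omega>_def using assms by (intro alt_form_cong) (auto simp: list_all2_conv_all_nth)

lemma map_upd_split:
  assumes "t < k"
  shows "map (x(t := v)) [0..<k] = map x [0..<t] @ v # map x [Suc t..<k]"
proof -
  have "[0..<k] = [0..<t] @ t # [Suc t..<k]"
    using assms upt_add_eq_append[of 0 t "k - t"] upt_conv_Cons[of t k] by simp
  then show ?thesis by simp
qed

lemma \<omega>_linear:
  assumes "t < k"
  shows "\<omega> (x(t := \<lambda>i. v i + c * w i)) = \<omega> (x(t := v)) + c * \<omega> (x(t := w))"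
  unfolding \<omega>_def map_upd_split[OF assms] by (rule alt_form_linear)

lemma \<omega>_add: "t < k \<Longrightarrow> \<omega> (x(t := \<lambda>i. v i + w i)) = \<omega> (x(t := v)) + \<omega> (x(t := w))"
  using \<omega>_linear[of t x v 1 w] by simp

lemma \<omega>_zero:
  assumes "t < k"
  shows "\<omega> (x(t := \<lambda>i. 0)) = 0"
proof -
  have "\<omega> (x(t := \<lambda>i. 0 + 0 * 0)) = \<omega> (x(t := \<lambda>i. 0)) + (- 1) * \<omega> (x(t := \<lambda>i. 0))"
    using \<omega>_linear[OF assms, of x "\<lambda>i. 0" "- 1" "\<lambda>i. 0"] by (simp only: mult_zero_right mult_zero_left)
  then show ?thesis by (simp only: mult_zero_right add_0_right mult_minus1 right_minus)
qed

lemma \<omega>_scale: "t < k \<Longrightarrow> \<omega> (x(t := \<lambda>i. c * w i)) = c * \<omega> (x(t := w))"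
  using \<omega>_linear[of t x "\<lambda>i. 0" c w] by (simp add: \<omega>_zero)

text \<open>Read off from the minors, since the recursion of \<open>alt_form\<close> singles out its
  first argument and hides the symmetry.\<close>

lemma \<omega>_alternating:
  assumes "s < k" "t < k" "s \<noteq> t" and "\<And>i. i < n \<Longrightarrow> x s i = x t i"
  shows "\<omega> x = 0"
  unfolding \<omega>_eq_sum_det
proof (intro sum.neutral ballI)
  fix I assume "I \<in> index_sets n k"
  then have "pick I p < n" if "p < k" for p
    using that pick_in_set_le[of p I] by (auto simp: index_sets_def)
  then have "det (mat k k (\<lambda>(p, t). x t (pick I p))) = 0"
    using assms by (intro det_identical_columns[of _ k s t]) (auto intro!: eq_vecI)
  then show "(\<Prod>i\<in>I. (- 1) ^ i) * det (mat k k (\<lambda>(p, t). x t (pick I p))) = 0" by simp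
qed

lemma \<omega>_swap:
  assumes "s < k" "t < k" "s \<noteq> t"
  shows "\<omega> (x(s := w, t := v)) = - \<omega> (x(s := v, t := w))"
proof -
  let ?a = "\<lambda>i. v i + w i"
  have twist: "x(s := a, t := b) = x(t := b, s := a)" for a b
    using assms(3) by (rule fun_upd_twist)
  have split: "\<omega> (x(s := ?a, t := b)) = \<omega> (x(s := v, t := b)) + \<omega> (x(s := w, t := b))" for b
    unfolding twist using assms(1) by (rule \<omega>_add)
  have eq0: "\<omega> (x(s := b, t := b)) = 0" for b
    using assms by (intro \<omega>_alternating[of s t]) auto
  have "0 = \<omega> (x(s := ?a, t := v)) + \<omega> (x(s := ?a, t := w))"
    using eq0[of ?a] \<omega>_add[OF assms(2), of "x(s := ?a)" v w] by simp
  also have "\<dots> = \<omega> (x(s := w, t := v)) + \<omega> (x(s := v, t := w))"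
    by (simp only: split eq0) simp
  finally show ?thesis by (simp add: eq_neg_iff_add_eq_0)
qed

lemma \<omega>_one:
  assumes "t < k"
  shows "\<omega> (x(t := \<lambda>_. 1)) = (0::'a::field)"
proof -
  \<comment> \<open>\<open>alt_form_1\<close> covers the constant in the last position only; the
    other positions follow by a swap.\<close>
  have last: "\<omega> (x(k - 1 := \<lambda>_. 1)) = (0::'a)" for x
  proof -
    have "map (x(k - 1 := \<lambda>_. 1)) [0..<k] = map x [0..<k - 1] @ [\<lambda>_. 1]"
      using k_ge map_upd_split[of "k - 1" x "\<lambda>_. 1"] by simp
    then show ?thesis
      using alt_form_1[of "{}" n "map x [0..<k - 1]"] k_ge parity by (simp add: \<omega>_def)
  qed
  show ?thesis
  proof (cases "t = k - 1")
    case False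
    then have "\<omega> (x(t := \<lambda>_. 1)) = \<omega> (x(t := \<lambda>_. 1, k - 1 := x (k - 1)))"
      by (intro arg_cong[of _ _ \<omega>]) auto
    also have "\<dots> = - \<omega> (x(t := x (k - 1), k - 1 := \<lambda>_. 1))"
      using False assms by (intro \<omega>_swap) auto
    finally show ?thesis using last by simp
  qed (use last in simp)
qed

text \<open>Constants lie in the radical, so \<omega> is well defined modulo equal rows. The columns
  are shifted one at a time.\<close>

lemma \<omega>_shift:
  "\<omega> (\<lambda>t i. x t i + c t) = \<omega> x"
proof -
  have "\<omega> (\<lambda>t i. x t i + (if t < j then c t else 0)) = \<omega> x" if "j \<le> k" for j
    using that
  proof (induction j)
    case (Suc j)
    let ?y = "\<lambda>t i. x t i + (if t < j then c t else 0)"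
    have "\<omega> (\<lambda>t i. x t i + (if t < Suc j then c t else 0)) = \<omega> (?y(j := \<lambda>i. ?y j i + c j * 1))"
      by (intro arg_cong[of _ _ \<omega>]) (auto simp: fun_eq_iff less_Suc_eq)
    also have "\<dots> = \<omega> (?y(j := ?y j)) + c j * \<omega> (?y(j := \<lambda>_. 1))"
      using Suc.prems by (intro \<omega>_linear) auto
    also have "?y(j := ?y j) = ?y" by (rule fun_upd_triv)
    also have "\<omega> (?y(j := \<lambda>_. 1)) = 0" using Suc.prems by (intro \<omega>_one) simp
    finally show ?case using Suc by simp
  qed simp
  from this[of k] have "\<omega> (\<lambda>t i. x t i + (if t < k then c t else 0)) = \<omega> x" by simp
  moreover have "\<omega> (\<lambda>t i. x t i + (if t < k then c t else 0)) = \<omega> (\<lambda>t i. x t i + c t)"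
    by (intro \<omega>_cong) auto
  ultimately show ?thesis by simp
qed

end

section \<open>Dual columns and perpendicular vectors\<close>

context cullis_form
begin

lemma \<omega>_list:
  assumes "length xs = k"
  shows "\<omega> (\<lambda>t. xs ! t) = alt_form n (\<lambda>a. (- 1) ^ a) xs"
  using assms by (auto simp: \<omega>_def map_nth)

text \<open>Provides what the two pair lemmas assume about weights: each q in K lies on the same
  side of i and \<open>Suc i\<close>, so only the factor \<open>(- 1) ^ b\<close> changes between
  them.\<close>

lemma list_tail_pair:
  fixes ys :: "(nat \<Rightarrow> 'a::field) list"
  assumes "distinct K" "set K \<subseteq> {..<n}" "i \<notin> set K" "Suc i \<notin> set K" "Suc i < n"
  defines "\<theta> \<equiv> \<lambda>b. (- 1 :: 'a) ^ b * (\<Prod>q\<in>set K. order_sign q b)"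
  obtains c where "c \<noteq> 0"
    "\<And>ys. alt_form n (\<lambda>a. (- 1) ^ a) (map unit_fun K @ ys) = c * alt_form n \<theta> ys"
    "\<theta> i * \<theta> i = 1" "\<theta> (Suc i) = - \<theta> i"
proof -
  obtain c where c: "c \<noteq> 0"
    "\<And>ys. alt_form n (\<lambda>a. (- 1 :: 'a) ^ a) (map unit_fun K @ ys) = c * alt_form n \<theta> ys"
    using alt_form_unit_funs[OF assms(1,2), of "\<lambda>a. (- 1 :: 'a) ^ a"] unfolding \<theta>_def by auto
  have sq: "(\<Prod>q\<in>set K. order_sign q i) * (\<Prod>q\<in>set K. order_sign q i) = (1::'a)"
    unfolding prod.distrib[symmetric] using assms(3) by (intro prod.neutral) (auto simp: order_sign_def)
  have "(\<Prod>q\<in>set K. order_sign q (Suc i)) = (\<Prod>q\<in>set K. order_sign q i :: 'a)"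
    using assms(3,4) by (intro prod.cong) (auto simp: order_sign_def not_less_eq less_Suc_eq)
  then show ?thesis
    using c sq that by (simp add: \<theta>_def mult_ac)
qed

text \<open>Unit vectors away from i and \<open>Suc i\<close> fill k - 2 columns and the sum of the
  two neighbouring unit vectors fills one more; \<open>alt_form_pair_1\<close> evaluates the free
  column.\<close>

lemma dual_column_last:
  assumes "Suc i < n"
  shows "\<exists>x :: nat \<Rightarrow> nat \<Rightarrow> 'a::field. \<forall>y. \<omega> (x(k - 1 := y)) = y i - y (Suc i)"
proof -
  have "k - 2 \<le> card ({..<n} - {i, Suc i})"
    using assms n_ge by (subst card_Diff_subset) auto
  then obtain A where A: "A \<subseteq> {..<n} - {i, Suc i}" "card A = k - 2" "finite A"
    by (meson obtain_subset_with_card_n)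
  obtain K where K: "set K = A" "distinct K" using finite_distinct_list[OF A(3)] by blast
  then have len: "length K = k - 2" using A distinct_card[of K] by simp
  define \<theta> where "\<theta> b = (- 1 :: 'a) ^ b * (\<Prod>q\<in>set K. order_sign q b)" for b
  obtain c where c: "c \<noteq> 0"
    "\<And>ys. alt_form n (\<lambda>a. (- 1) ^ a) (map unit_fun K @ ys) = c * alt_form n \<theta> ys"
    "\<theta> i * \<theta> i = 1" "\<theta> (Suc i) = - \<theta> i"
    using list_tail_pair[of K i, where 'a = 'a] K A assms unfolding \<theta>_def by blast
  have val: "alt_form n (\<lambda>a. (- 1) ^ a)
      (map unit_fun K @ [\<lambda>j. unit_fun i j + unit_fun (Suc i) j, y]) = c * (y i - y (Suc i))" for y
    using alt_form_pair_1[OF assms c(3,4), of y] c(2) by simp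
  define L :: "(nat \<Rightarrow> 'a) list" where "L = map unit_fun K @ [\<lambda>j. unit_fun i j + unit_fun (Suc i) j]"
  have L: "length L = k - 1" using len k_ge by (simp add: L_def)
  have last: "\<omega> ((\<lambda>t. L ! t)(k - 1 := y)) = c * (y i - y (Suc i))" for y
  proof -
    have "\<omega> ((\<lambda>t. L ! t)(k - 1 := y)) = \<omega> (\<lambda>t. (L @ [y]) ! t)"
      using L by (intro \<omega>_cong) (auto simp: nth_append)
    also have "\<dots> = alt_form n (\<lambda>a. (- 1) ^ a) (L @ [y])"
      using L k_ge by (intro \<omega>_list) simp
    finally show ?thesis using val by (simp add: L_def)
  qed
  \<comment> \<open>Column 0 absorbs the scalar c; it differs from the free column k - 1 since k is
    at least 3.\<close>
  define x where "x = (\<lambda>t. L ! t)(0 := \<lambda>i. (1 / c) * (L ! 0) i)"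
  have "\<omega> (x(k - 1 := y)) = y i - y (Suc i)" for y
  proof -
    define f where "f = (\<lambda>t. L ! t)(k - 1 := y)"
    have ne: "0 \<noteq> k - 1" using k_ge by arith
    have f0: "f 0 = L ! 0" unfolding f_def using ne by (rule fun_upd_other)
    have "x(k - 1 := y) = f(0 := \<lambda>i. (1 / c) * f 0 i)"
      unfolding f0 unfolding x_def f_def using ne by (rule fun_upd_twist)
    moreover have "\<omega> (f(0 := \<lambda>i. (1 / c) * f 0 i)) = (1 / c) * \<omega> (f(0 := f 0))"
      by (intro \<omega>_scale) (use k_ge in arith)
    moreover have "\<omega> f = c * (y i - y (Suc i))" unfolding f_def by (rule last)
    ultimately show ?thesis using c(1) by (simp only: fun_upd_triv) simp
  qed
  then show ?thesis by blast
qed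

text \<open>Moving the free column from k - 1 to t costs a sign, absorbed by the column that is
  moved to k - 1. The entry at t is free, and setting it to zero later kills every other term of the
  differential.\<close>

lemma dual_column:
  assumes "t < k" and "Suc i < n"
  shows "\<exists>x :: nat \<Rightarrow> nat \<Rightarrow> 'a::field. x t = (\<lambda>_. 0) \<and> (\<forall>y. \<omega> (x(t := y)) = y i - y (Suc i))"
proof -
  obtain x :: "nat \<Rightarrow> nat \<Rightarrow> 'a" where x: "\<And>y. \<omega> (x(k - 1 := y)) = y i - y (Suc i)"
    using dual_column_last[OF assms(2)] by blast
  have "\<exists>x :: nat \<Rightarrow> nat \<Rightarrow> 'a. \<forall>y. \<omega> (x(t := y)) = y i - y (Suc i)"
  proof (cases "t = k - 1")
    case False
    have "\<omega> (x(k - 1 := \<lambda>j. - 1 * x t j, t := y)) = y i - y (Suc i)" for y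
    proof -
      have "\<omega> (x(k - 1 := \<lambda>j. - 1 * x t j, t := y)) = \<omega> ((x(t := y))(k - 1 := \<lambda>j. - 1 * x t j))"
        using False by (subst fun_upd_twist) auto
      also have "\<dots> = - 1 * \<omega> ((x(t := y))(k - 1 := x t))"
        using k_ge by (intro \<omega>_scale) simp
      also have "\<omega> (x(t := y, k - 1 := x t)) = - \<omega> (x(t := x t, k - 1 := y))"
        using False assms by (intro \<omega>_swap) auto
      finally show ?thesis by (simp only: fun_upd_triv x mult_minus1 minus_minus)
    qed
    then show ?thesis by blast
  qed (use x in blast)
  then obtain x :: "nat \<Rightarrow> nat \<Rightarrow> 'a" where "\<And>y. \<omega> (x(t := y)) = y i - y (Suc i)" by blast
  then show ?thesis by (intro exI[of _ "x(t := \<lambda>_. 0)"]) simp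
qed

text \<open>The contraction of the k-form by v and w vanishes. By \<open>perp_iff\<close> the choice
  of the two positions is immaterial.\<close>

definition perp :: "(nat \<Rightarrow> 'a::field) \<Rightarrow> (nat \<Rightarrow> 'a) \<Rightarrow> bool" where
  "perp v w \<longleftrightarrow> (\<forall>y. \<omega> (y(k - 2 := v, k - 1 := w)) = 0)"

lemma perp_at:
  assumes "s < k" "t < k" "s \<noteq> t" and "s' < k" "t' < k" "s' \<noteq> t'"
    and "\<And>y. \<omega> (y(s := v, t := w)) = (0::'a::field)"
  shows "\<omega> (y(s' := v, t' := w)) = 0"
proof -
  have one: "\<omega> (y(s := v, t' := w)) = 0" if "s < k" "t < k" "s \<noteq> t" "t' < k" "s \<noteq> t'"
    "\<And>y. \<omega> (y(s := v, t := w)) = 0" for s t t' v w and y :: "nat \<Rightarrow> nat \<Rightarrow> 'a"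
  proof (cases "t = t'")
    case False
    have "\<omega> (y(s := v, t' := w)) = \<omega> ((y(s := v))(t := y t, t' := w))"
      by (intro arg_cong[of _ _ \<omega>] ext) (use that(3,5) False in auto)
    also have "\<dots> = - \<omega> ((y(s := v))(t := w, t' := y t))"
      using that False by (intro \<omega>_swap) auto
    also have "(y(s := v))(t := w, t' := y t) = (y(t' := y t))(s := v, t := w)"
      by (rule ext) (use that(3,5) False in auto)
    finally show ?thesis by (simp only: that(6) minus_zero)
  next
    case True
    with that(6)[of y] show ?thesis by simp
  qed
  have flip: "\<omega> (y(t := w, s := v)) = 0" if "\<And>y. \<omega> (y(s := v, t := w)) = 0" "s \<noteq> t"
    for s t v w and y :: "nat \<Rightarrow> nat \<Rightarrow> 'a"
    using that by (subst fun_upd_twist) auto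
  \<comment> \<open>A third position, available because k is at least 3, serves as parking space
    while v and w are moved one after the other.\<close>
  obtain r where r: "r < k" "r \<noteq> s" "r \<noteq> s'"
  proof -
    have "\<not> {..<k} \<subseteq> {s, s'}"
      using card_mono[of "{s, s'}" "{..<k}"] k_ge card_insert_le_m1[of 2 "{s'}" s] by auto
    then show ?thesis using that by auto
  qed
  have "\<omega> (y(s := v, r := w)) = 0" for y using one[OF assms(1-3), of r v w] r assms by auto
  then have "\<omega> (y(r := w, s := v)) = 0" for y by (rule flip) (use r in auto)
  then have "\<omega> (y(r := w, s' := v)) = 0" for y using one[of r s s' w v] r assms by auto
  then have "\<omega> (y(s' := v, r := w)) = 0" for y by (rule flip) (use r in auto)
  then show ?thesis using one[of s' r t' v w] r assms by auto
qed

lemma perp_iff: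
  assumes "s < k" "t < k" "s \<noteq> t"
  shows "perp v w \<longleftrightarrow> (\<forall>y. \<omega> (y(s := v, t := w)) = 0)"
  using perp_at[OF assms, of "k - 2" "k - 1" v w] perp_at[of "k - 2" "k - 1" s t v w] assms k_ge
  unfolding perp_def by auto

text \<open>The functional u: unit vectors at 0, ..., k - 4 leave the weight zero there and
  \<open>(- 1) ^ a\<close> from k - 3 on.\<close>

definition test_fun :: "(nat \<Rightarrow> 'a::field) \<Rightarrow> 'a" where
  "test_fun y = (\<Sum>a\<in>{k - 3..<n}. (- 1) ^ a * y a)"

lemma test_fun_linear: "test_fun (\<lambda>i. v i + c * w i) = test_fun v + c * test_fun w"
  by (simp add: test_fun_def sum.distrib sum_distrib_left algebra_simps)

text \<open>The vanishing contraction is evaluated at the unit vectors of K and the sum of two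
  neighbouring ones, k - 2 columns in all, and \<open>alt_form_pair_2\<close> computes it.\<close>

lemma perp_pair:
  fixes v w :: "nat \<Rightarrow> 'a::field"
  assumes "perp v w" and "distinct K" "set K \<subseteq> {..<n}" "i \<notin> set K" "Suc i \<notin> set K" "Suc i < n"
    and "length K = k - 3"
  defines "\<theta> \<equiv> \<lambda>b. (- 1 :: 'a) ^ b * (\<Prod>q\<in>set K. order_sign q b)"
  shows "(v i - v (Suc i)) * (\<Sum>c<n. \<theta> c * w c) = (w i - w (Suc i)) * (\<Sum>c<n. \<theta> c * v c)"
proof -
  obtain c where c: "c \<noteq> 0"
    "\<And>ys. alt_form n (\<lambda>a. (- 1) ^ a) (map unit_fun K @ ys) = c * alt_form n \<theta> ys"
    "\<theta> i * \<theta> i = 1" "\<theta> (Suc i) = - \<theta> i"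
    using list_tail_pair[OF assms(2-6), where 'a = 'a] unfolding \<theta>_def by blast
  define L where "L = map unit_fun K @ [\<lambda>j. unit_fun i j + unit_fun (Suc i) j :: 'a]"
  have L: "length L = k - 2" "length (L @ [v]) = k - 1" using assms(7) k_ge by (auto simp: L_def)
  define y where "y = (\<lambda>t. (L @ [v, w]) ! t)"
  have "y (k - 2) = v" unfolding y_def L(1)[symmetric] by (rule nth_append_length)
  moreover have "y (k - 1) = w"
    using nth_append_length[of "L @ [v]" w "[]"] unfolding y_def L(2)[symmetric] by simp
  ultimately have "y(k - 2 := v, k - 1 := w) = y" by (metis fun_upd_idem)
  then have "0 = \<omega> y" using assms(1) unfolding perp_def by metis
  also have "\<dots> = alt_form n (\<lambda>a. (- 1) ^ a) (L @ [v, w])"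
    unfolding y_def using L k_ge by (intro \<omega>_list) simp
  also have "\<dots> = c * alt_form n \<theta> [\<lambda>j. unit_fun i j + unit_fun (Suc i) j, v, w]"
    using c(2) by (simp add: L_def)
  finally have "alt_form n \<theta> [\<lambda>j. unit_fun i j + unit_fun (Suc i) j, v, w] = 0" using c(1) by simp
  then show ?thesis using alt_form_pair_2[OF assms(6) c(3,4), of v w] by simp
qed

lemma perp_linear:
  assumes "perp v w" and "perp v w'"
  shows "perp v (\<lambda>i. w i + c * w' i)"
proof -
  have "k - 1 < k" using k_ge by simp
  with assms show ?thesis unfolding perp_def by (simp only: \<omega>_linear) simp
qed

lemma perp_self: "perp v v"
  using k_ge unfolding perp_def by (auto intro!: \<omega>_alternating[of "k - 2" "k - 1"])

lemma perp_commute: "perp v w \<longleftrightarrow> perp w v"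
proof -
  have "k - 2 < k" "k - 1 < k" "k - 2 \<noteq> k - 1" using k_ge by auto
  from \<omega>_swap[OF this] show ?thesis unfolding perp_def by (metis neg_equal_0_iff_equal)
qed

text \<open>The range has n - k + 3 elements, an even number; hence \<open>test_fun\<close> vanishes
  on constants.\<close>

lemma sum_tail_weights: "(\<Sum>a\<in>{k - 3..<n}. (- 1) ^ a) = (0::'a::field)"
proof -
  have *: "(\<Sum>a\<in>{m..<m + 2 * j}. (- 1) ^ a) = (0::'a)" for m j
    by (induction j) auto
  have "\<exists>j. n = (k - 3) + 2 * j" using k_ge n_ge parity by presburger
  then show ?thesis using * by metis
qed

lemma perp_const_tail:
  fixes v w :: "nat \<Rightarrow> 'a::field"
  assumes "perp v w" and "test_fun v \<noteq> 0" and "test_fun w = 0"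
    and i: "k - 3 \<le> i" "Suc i < n"
  shows "w i = w (Suc i)"
proof -
  have \<theta>: "(\<Sum>c<n. (- 1 :: 'a) ^ c * (\<Prod>q\<in>set [0..<k - 3]. order_sign q c) * y c) = test_fun y" for y
  proof -
    have "(\<Sum>c<n. (- 1 :: 'a) ^ c * (\<Prod>q\<in>set [0..<k - 3]. order_sign q c) * y c) =
        (\<Sum>c\<in>{k - 3..<n}. (- 1 :: 'a) ^ c * (\<Prod>q\<in>set [0..<k - 3]. order_sign q c) * y c)"
      by (intro sum.mono_neutral_right) (auto simp: not_le intro!: prod_zero)
    also have "\<dots> = test_fun y" unfolding test_fun_def
      by (intro sum.cong) (auto intro!: prod.neutral)
    finally show ?thesis .
  qed
  have "set [0..<k - 3] \<subseteq> {..<n}" using n_ge by auto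
  then have "(v i - v (Suc i)) * test_fun w = (w i - w (Suc i)) * test_fun v"
    using perp_pair[OF assms(1), of "[0..<k - 3]" i] i n_ge unfolding \<theta> by auto
  with assms show ?thesis by simp
qed

theorem perp_imp_proportional:
  fixes v w :: "nat \<Rightarrow> 'a::field"
  assumes "perp v w" and v: "test_fun v \<noteq> 0"
  shows "\<exists>c d. \<forall>i<n. w i = c * v i + d"
proof -
  define c where "c = test_fun w / test_fun v"
  define w' where "w' = (\<lambda>i. w i + (- c) * v i)"
  have perp': "perp v w'" unfolding w'_def by (intro perp_linear assms perp_self)
  have "test_fun w' = 0" unfolding w'_def test_fun_linear using v by (simp add: c_def)
  note step = perp_const_tail[OF perp' v this]
  define d where "d = w' (k - 3)"
  have tail: "w' i = d" if "k - 3 \<le> i" "i < n" for i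
    using that
  proof (induction i rule: dec_induct)
    case (step i)
    with \<open>\<And>i. k - 3 \<le> i \<Longrightarrow> Suc i < n \<Longrightarrow> w' i = w' (Suc i)\<close> show ?case by simp
  qed (simp add: d_def)
  \<comment> \<open>\<open>test_fun\<close> vanishes on functions constant from k - 3 on, so v has a
    jump there. This jump is the pivot for the entries below k - 3.\<close>
  obtain i where i: "k - 3 \<le> i" "Suc i < n" "v i \<noteq> v (Suc i)"
  proof -
    have "\<exists>i\<ge>k - 3. Suc i < n \<and> v i \<noteq> v (Suc i)"
    proof (rule ccontr)
      assume *: "\<not> ?thesis"
      have const: "v i = v (k - 3)" if "k - 3 \<le> i" "i < n" for i
        using that
      proof (induction i rule: dec_induct)
        case (step i)
        with * show ?case by (metis Suc_lessD)
      qed simp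
      have "test_fun v = (\<Sum>a\<in>{k - 3..<n}. (- 1) ^ a * v (k - 3))"
        unfolding test_fun_def
      proof (intro sum.cong refl)
        fix a assume "a \<in> {k - 3..<n}"
        then show "(- 1) ^ a * v a = (- 1) ^ a * v (k - 3)" using const[of a] by simp
      qed
      also have "\<dots> = 0" by (simp only: sum_distrib_right[symmetric] sum_tail_weights) simp
      finally show False using v by simp
    qed
    with that show ?thesis by blast
  qed
  have head: "w' r = d" if r: "r < k - 3" for r
  proof -
    \<comment> \<open>The tail has at least five entries because n is at least k + 2. Exchanging r
      for j in K makes r the only index below k - 3 with nonzero weight.\<close>
    obtain j where j: "k - 3 \<le> j" "j < n" "j \<noteq> i" "j \<noteq> Suc i"
    proof -
      have "\<not> {k - 3..<n} \<subseteq> {i, Suc i}"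
        using card_mono[of "{i, Suc i}" "{k - 3..<n}"] n_ge k_ge by auto
      then obtain x where "x \<in> {k - 3..<n}" "x \<notin> {i, Suc i}" by blast
      then show ?thesis by (intro that[of x]) auto
    qed
    define K where "K = j # filter (\<lambda>q. q \<noteq> r) [0..<k - 3]"
    have set_K: "set K = insert j ({..<k - 3} - {r})" by (auto simp: K_def)
    have dist: "distinct K" using j by (auto simp: K_def)
    have card_K: "card (set K) = k - 3" unfolding set_K using j r by (subst card_insert_disjoint) auto
    have len: "length K = k - 3" using distinct_card[OF dist] card_K by simp
    define \<theta> where "\<theta> b = (- 1 :: 'a) ^ b * (\<Prod>q\<in>set K. order_sign q b)" for b
    have sub: "set K \<subseteq> {..<n}" unfolding set_K using j n_ge by auto
    have "(v i - v (Suc i)) * (\<Sum>c<n. \<theta> c * w' c) = (w' i - w' (Suc i)) * (\<Sum>c<n. \<theta> c * v c)"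
      unfolding \<theta>_def using perp' dist sub len i j by (intro perp_pair) (auto simp: set_K)
    then have 0: "(\<Sum>c<n. \<theta> c * w' c) = 0" using tail i by simp
    have 1: "(\<Sum>c<n. \<theta> c) = 0"
      unfolding \<theta>_def using sub card_K parity k_ge by (subst sum_order_sign) auto
    \<comment> \<open>The weights sum to zero, so subtracting d is free. It removes all tail
      entries; below k - 3 the weight removes all but r.\<close>
    have "0 = (\<Sum>c<n. \<theta> c * (w' c - d))"
      using 0 1 by (simp add: right_diff_distrib sum_subtractf sum_distrib_right[symmetric])
    also have "\<dots> = (\<Sum>c\<in>{r}. \<theta> c * (w' c - d))"
    proof (intro sum.mono_neutral_right ballI)
      fix c assume c: "c \<in> {..<n} - {r}"
      show "\<theta> c * (w' c - d) = 0"
      proof (cases "k - 3 \<le> c")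
        case False
        with c have "c \<in> set K" by (auto simp: set_K)
        then have "(\<Prod>q\<in>set K. order_sign q c) = (0::'a)" by (intro prod_zero) auto
        then show ?thesis by (simp add: \<theta>_def)
      qed (use tail c in auto)
    qed (use r n_ge in auto)
    finally have "\<theta> r * (w' r - d) = 0" by simp
    moreover have "\<theta> r \<noteq> 0" using r j by (auto simp: \<theta>_def set_K)
    ultimately show ?thesis by simp
  qed
  have "w i = c * v i + d" if "i < n" for i
    using tail[of i] head[of i] that by (cases "k - 3 \<le> i") (auto simp: w'_def algebra_simps)
  then show ?thesis by blast
qed

end

section \<open>Coefficient comparison and one-sided inverses\<close>

text \<open>The difference is a polynomial of degree at most k that vanishes on the whole field,
  hence has more than k roots.\<close>

lemma power_sum_coeffs_eq:
  fixes a b :: "nat \<Rightarrow> 'a::field"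
  assumes "infinite (UNIV :: 'a set) \<or> card (UNIV :: 'a set) > k"
    and eq: "\<And>c. (\<Sum>r\<le>k. c ^ r * a r) = (\<Sum>r\<le>k. c ^ r * b r)" and "r \<le> k"
  shows "a r = b r"
proof -
  define p where "p = (\<Sum>r\<le>k. monom (a r - b r) r)"
  have coeff: "coeff p r = a r - b r" using \<open>r \<le> k\<close> by (simp add: p_def coeff_sum)
  have "poly p c = 0" for c
    using eq[of c] by (simp add: p_def poly_sum poly_monom algebra_simps sum_subtractf)
  then have roots: "{c. poly p c = 0} = UNIV" by simp
  have "p = 0"
  proof (rule ccontr)
    assume "p \<noteq> 0"
    then have "finite (UNIV :: 'a set)" and "card (UNIV :: 'a set) \<le> degree p"
      using poly_roots_finite[of p] card_poly_roots_bound[of p] unfolding roots by auto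
    moreover have "degree p \<le> k"
      unfolding p_def by (intro degree_sum_le) (auto intro: order_trans[OF degree_monom_le])
    ultimately show False using assms(1) by auto
  qed
  with coeff show ?thesis by simp
qed

lemma sum_mult_left_right_inverse:
  fixes Q S :: "'b \<Rightarrow> 'b \<Rightarrow> 'a::field"
  assumes "finite A"
    and inv: "\<And>a b. a \<in> A \<Longrightarrow> b \<in> A \<Longrightarrow> (\<Sum>c\<in>A. Q a c * S c b) = (if a = b then 1 else 0)"
    and "a \<in> A" "b \<in> A"
  shows "(\<Sum>c\<in>A. S a c * Q c b) = (if a = b then 1 else 0)"
proof -
  define N where "N = card A"
  obtain h where h: "bij_betw h {0..<N} A"
    using ex_bij_betw_nat_finite[OF assms(1)] unfolding N_def by blast
  have hA: "h i \<in> A" if "i < N" for i using h that by (auto simp: bij_betw_def)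
  have h_eq: "h i = h j \<longleftrightarrow> i = j" if "i < N" "j < N" for i j
    using h that by (auto simp: bij_betw_def inj_on_def)
  have sum: "(\<Sum>l\<in>{0..<N}. q (h l)) = (\<Sum>c\<in>A. q c)" for q :: "'b \<Rightarrow> 'a"
    by (rule sum.reindex_bij_betw[OF h])
  define MQ where "MQ = mat N N (\<lambda>(i, j). Q (h i) (h j))"
  define MS where "MS = mat N N (\<lambda>(i, j). S (h i) (h j))"
  have carr: "MQ \<in> carrier_mat N N" "MS \<in> carrier_mat N N" by (auto simp: MQ_def MS_def)
  have "MQ * MS = 1\<^sub>m N"
  proof (intro eq_matI)
    fix i j assume "i < dim_row (1\<^sub>m N :: 'a mat)" "j < dim_col (1\<^sub>m N :: 'a mat)"
    then have ij: "i < N" "j < N" by auto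
    then have "(MQ * MS) $$ (i, j) = (\<Sum>l\<in>{0..<N}. Q (h i) (h l) * S (h l) (h j))"
      by (simp add: MQ_def MS_def scalar_prod_def)
    also have "\<dots> = (if h i = h j then 1 else 0)"
      using sum[of "\<lambda>c. Q (h i) c * S c (h j)"] inv[OF hA hA] ij by simp
    finally show "(MQ * MS) $$ (i, j) = 1\<^sub>m N $$ (i, j)" using ij h_eq by simp
  qed (auto simp: MQ_def MS_def)
  then have SQ: "MS * MQ = 1\<^sub>m N" by (rule mat_mult_left_right_inverse[OF carr])
  obtain i j where ij: "i < N" "j < N" "a = h i" "b = h j"
    using assms(3,4) h by (auto simp: bij_betw_def image_iff)
  have "(\<Sum>c\<in>A. S a c * Q c b) = (\<Sum>l\<in>{0..<N}. S (h i) (h l) * Q (h l) (h j))"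
    using sum[of "\<lambda>c. S a c * Q c b"] ij by simp
  also have "\<dots> = (MS * MQ) $$ (i, j)" using ij by (simp add: MQ_def MS_def scalar_prod_def)
  also have "\<dots> = (if a = b then 1 else 0)" unfolding SQ using ij h_eq by simp
  finally show ?thesis .
qed

section \<open>Polarisation and coordinates modulo equal rows\<close>

context cullis_form
begin

text \<open>The coefficient of c^r in \<omega> (x + c z); in particular \<open>polar 1 x\<close> is
  the differential of \<omega> at x.\<close>

definition polar :: "nat \<Rightarrow> (nat \<Rightarrow> nat \<Rightarrow> 'a::field) \<Rightarrow> (nat \<Rightarrow> nat \<Rightarrow> 'a) \<Rightarrow> 'a" where
  "polar r x z = (\<Sum>S | S \<subseteq> {..<k} \<and> card S = r. \<omega> (\<lambda>t. if t \<in> S then z t else x t))"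

text \<open>Column j contributes x j or c times z j. The second case is the induction hypothesis at
  \<open>x(j := z j)\<close>, hence the induction over all x.\<close>

lemma \<omega>_combination_aux:
  "j \<le> k \<Longrightarrow> \<omega> (\<lambda>t. if t < j then (\<lambda>i. x t i + c * z t i) else x t) =
    (\<Sum>S\<in>Pow {..<j}. c ^ card S * \<omega> (\<lambda>t. if t \<in> S then z t else x t))"
proof (induction j arbitrary: x)
  case 0
  then show ?case by simp
next
  case (Suc j)
  let ?f = "\<lambda>j x t. if t < j then (\<lambda>i. x t i + c * z t i) else x t"
  let ?g = "\<lambda>S x t. if t \<in> S then z t else x t"
  have upd: "(?f j x)(j := v) = ?f j (x(j := v))" for v by (rule ext) auto
  have "?f (Suc j) x = (?f j x)(j := \<lambda>i. x j i + c * z j i)" by (rule ext) auto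
  then have "\<omega> (?f (Suc j) x) = \<omega> ((?f j x)(j := \<lambda>i. x j i + c * z j i))" by (simp only:)
  also have "\<dots> = \<omega> ((?f j x)(j := x j)) + c * \<omega> ((?f j x)(j := z j))"
    using Suc.prems by (intro \<omega>_linear) simp
  also have "\<omega> ((?f j x)(j := x j)) = (\<Sum>S\<in>Pow {..<j}. c ^ card S * \<omega> (?g S x))"
    unfolding upd fun_upd_triv using Suc.prems by (intro Suc.IH) simp
  also have "\<omega> ((?f j x)(j := z j)) = (\<Sum>S\<in>Pow {..<j}. c ^ card S * \<omega> (?g S (x(j := z j))))"
    unfolding upd using Suc.prems by (intro Suc.IH) simp
  also have "c * \<dots> = (\<Sum>S\<in>Pow {..<j}. c ^ card (insert j S) * \<omega> (?g (insert j S) x))"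
    unfolding sum_distrib_left
  proof (intro sum.cong refl)
    fix S assume S: "S \<in> Pow {..<j}"
    then have "finite S" "j \<notin> S" using finite_subset[of S "{..<j}"] by auto
    then have card: "card (insert j S) = Suc (card S)" by (rule card_insert_disjoint)
    have g: "?g S (x(j := z j)) = ?g (insert j S) x" by (rule ext) auto
    show "c * (c ^ card S * \<omega> (?g S (x(j := z j)))) =
        c ^ card (insert j S) * \<omega> (?g (insert j S) x)" by (simp only: g card power_Suc mult.assoc)
  qed
  also have "\<dots> = (\<Sum>S\<in>insert j ` Pow {..<j}. c ^ card S * \<omega> (?g S x))"
    by (subst sum.reindex) (auto simp: inj_on_def)
  also have "(\<Sum>S\<in>Pow {..<j}. c ^ card S * \<omega> (?g S x)) + \<dots> =
      (\<Sum>S\<in>Pow {..<j} \<union> insert j ` Pow {..<j}. c ^ card S * \<omega> (?g S x))"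
    by (rule sum.union_disjoint[symmetric]) auto
  also have "Pow {..<j} \<union> insert j ` Pow {..<j} = Pow {..<Suc j}"
    by (simp only: lessThan_Suc Pow_insert)
  finally show ?case .
qed

lemma \<omega>_combination: "\<omega> (\<lambda>t i. x t i + c * z t i) = (\<Sum>r\<le>k. c ^ r * polar r x z)"
proof -
  let ?g = "\<lambda>S t. if t \<in> S then z t else x t"
  have "\<omega> (\<lambda>t i. x t i + c * z t i) = \<omega> (\<lambda>t. if t < k then (\<lambda>i. x t i + c * z t i) else x t)"
    by (intro \<omega>_cong) auto
  also have "\<dots> = (\<Sum>S\<in>Pow {..<k}. c ^ card S * \<omega> (?g S))"
    by (rule \<omega>_combination_aux) simp
  also have "\<dots> = (\<Sum>r\<le>k. \<Sum>S | S \<in> Pow {..<k} \<and> card S = r. c ^ card S * \<omega> (?g S))"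
    using card_mono[of "{..<k}"] by (intro sum.group[symmetric]) auto
  also have "\<dots> = (\<Sum>r\<le>k. c ^ r * polar r x z)"
    unfolding polar_def sum_distrib_left by (intro sum.cong) auto
  finally show ?thesis .
qed

lemma polar_1: "polar 1 x z = (\<Sum>t<k. \<omega> (x(t := z t)))"
proof -
  have "{S. S \<subseteq> {..<k} \<and> card S = 1} = (\<lambda>t. {t}) ` {..<k}"
    by (auto simp: card_1_singleton_iff)
  then have "polar 1 x z = (\<Sum>t<k. \<omega> (\<lambda>s. if s \<in> {t} then z s else x s))"
    unfolding polar_def by (simp add: sum.reindex)
  also have "\<dots> = (\<Sum>t<k. \<omega> (x(t := z t)))"
    by (intro sum.cong refl arg_cong[of _ _ \<omega>]) auto
  finally show ?thesis .
qed

lemma polar_complement: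
  assumes "r \<le> k"
  shows "polar (k - r) x z = polar r z x"
  unfolding polar_def
proof (rule sum.reindex_bij_witness[of _ "\<lambda>S. {..<k} - S" "\<lambda>S. {..<k} - S"])
  fix S assume "S \<in> {S. S \<subseteq> {..<k} \<and> card S = k - r}"
  then have S: "S \<subseteq> {..<k}" "card S = k - r" "finite S" by (auto intro: finite_subset)
  show "{..<k} - ({..<k} - S) = S" using S by auto
  show "{..<k} - S \<in> {S. S \<subseteq> {..<k} \<and> card S = r}"
    using S assms by (simp add: card_Diff_subset)
  show "\<omega> (\<lambda>t. if t \<in> {..<k} - S then x t else z t) = \<omega> (\<lambda>t. if t \<in> S then z t else x t)"
    by (intro \<omega>_cong) auto
next
  fix S assume "S \<in> {S. S \<subseteq> {..<k} \<and> card S = r}"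
  then have S: "S \<subseteq> {..<k}" "card S = r" "finite S" by (auto intro: finite_subset)
  show "{..<k} - ({..<k} - S) = S" using S by auto
  show "{..<k} - S \<in> {S. S \<subseteq> {..<k} \<and> card S = k - r}"
    using S by (simp add: card_Diff_subset)
qed

lemma polar_top: "polar k x z = \<omega> z"
proof -
  have "polar k x z = polar 0 z x" using polar_complement[of 0 x z] by simp
  also have "{S. S \<subseteq> {..<k} \<and> card S = 0} = {{}}"
    using finite_subset[of _ "{..<k}"] by auto
  then have "polar 0 z x = \<omega> z" unfolding polar_def by simp
  finally show ?thesis .
qed

text \<open>\<open>slope\<close> over all \<open>slots\<close> gives coordinates of the matrices modulo equal rows.\<close>

definition slope :: "nat \<times> nat \<Rightarrow> (nat \<Rightarrow> nat \<Rightarrow> 'a::field) \<Rightarrow> 'a" where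
  "slope p z = z (fst p) (snd p) - z (fst p) (Suc (snd p))"

text \<open>A canonical representative modulo equal rows. Being zero off the k by n - 1 block turns
  congruence into equality of functions.\<close>

definition normalize_rows :: "(nat \<Rightarrow> nat \<Rightarrow> 'a::field) \<Rightarrow> nat \<Rightarrow> nat \<Rightarrow> 'a" where
  "normalize_rows z t i = (if t < k \<and> i < n - 1 then z t i - z t (n - 1) else 0)"

definition slots :: "(nat \<times> nat) set" where
  "slots = {..<k} \<times> {..<n - 1}"

lemma finite_slots [simp]: "finite slots"
  by (simp add: slots_def)

lemma slope_linear: "slope p (\<lambda>t i. x t i + c * z t i) = slope p x + c * slope p z"
  by (simp add: slope_def algebra_simps)

lemma telescope:
  assumes "i \<le> n - 1"
  shows "z t i - z t (n - 1) = (\<Sum>l\<in>{i..<n - 1}. slope (t, l) z)"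
  using sum_Suc_diff'[OF assms, of "\<lambda>l. - z t l"] by (simp add: slope_def)

lemma normalize_rows_eq_iff:
  fixes x z :: "nat \<Rightarrow> nat \<Rightarrow> 'a::field"
  shows "normalize_rows x = normalize_rows z \<longleftrightarrow> (\<forall>p\<in>slots. slope p x = slope p z)"
proof
  assume eq: "normalize_rows x = normalize_rows z"
  have "x t i - x t (n - 1) = z t i - z t (n - 1)" if "t < k" "i \<le> n - 1" for t i
  proof (cases "i < n - 1")
    case True
    then show ?thesis using fun_cong[OF fun_cong[OF eq, of t], of i] that by (simp add: normalize_rows_def)
  qed (use that in auto)
  note e = this
  show "\<forall>p\<in>slots. slope p x = slope p z"
  proof
    fix p assume "p \<in> slots"
    then obtain t i where p: "p = (t, i)" "t < k" "i < n - 1" by (auto simp: slots_def)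
    have "slope p y = (y t i - y t (n - 1)) - (y t (Suc i) - y t (n - 1))" for y :: "nat \<Rightarrow> nat \<Rightarrow> 'a"
      by (simp add: p slope_def)
    moreover have "x t i - x t (n - 1) = z t i - z t (n - 1)"
      "x t (Suc i) - x t (n - 1) = z t (Suc i) - z t (n - 1)"
      by (rule e; use p in simp)+
    ultimately show "slope p x = slope p z" by (simp only:)
  qed
next
  assume *: "\<forall>p\<in>slots. slope p x = slope p z"
  show "normalize_rows x = normalize_rows z"
  proof (intro ext)
    fix t i
    show "normalize_rows x t i = normalize_rows z t i"
    proof (cases "t < k \<and> i < n - 1")
      case True
      then have "(\<Sum>l\<in>{i..<n - 1}. slope (t, l) x) = (\<Sum>l\<in>{i..<n - 1}. slope (t, l) z)"
        using * by (intro sum.cong) (auto simp: slots_def)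
      then have "x t i - x t (n - 1) = z t i - z t (n - 1)"
        using telescope[of i x t] telescope[of i z t] True by simp
      with True show ?thesis by (simp add: normalize_rows_def)
    qed (auto simp: normalize_rows_def)
  qed
qed

lemma normalize_rows_linear:
  "normalize_rows (\<lambda>t i. x t i + c * z t i) =
    (\<lambda>t i. normalize_rows x t i + c * normalize_rows z t i)"
  by (auto simp: normalize_rows_def fun_eq_iff algebra_simps)

lemma normalize_rows_idem [simp]: "normalize_rows (normalize_rows x) = normalize_rows x"
  by (auto simp: normalize_rows_def fun_eq_iff)

lemma \<omega>_normalize_rows [simp]: "\<omega> (normalize_rows x) = \<omega> x"
proof -
  have "\<omega> (normalize_rows x) = \<omega> (\<lambda>t i. x t i + (- x t (n - 1)))"
  proof (intro \<omega>_cong)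
    fix t i assume "t < k" "i < n"
    then show "normalize_rows x t i = x t i + (- x t (n - 1))"
      by (cases "i = n - 1") (auto simp: normalize_rows_def)
  qed
  also have "\<dots> = \<omega> x" by (rule \<omega>_shift)
  finally show ?thesis .
qed

lemma polar_normalize_rows [simp]: "polar r (normalize_rows x) (normalize_rows z) = polar r x z"
  unfolding polar_def
proof (intro sum.cong refl)
  fix S
  let ?g = "\<lambda>t. if t \<in> S then z t else x t"
  have "(\<lambda>t. if t \<in> S then normalize_rows z t else normalize_rows x t) = normalize_rows ?g"
    by (auto simp: normalize_rows_def fun_eq_iff)
  then show "\<omega> (\<lambda>t. if t \<in> S then normalize_rows z t else normalize_rows x t) = \<omega> ?g"
    by simp
qed

text \<open>The basis dual to the slopes: a step down directly after row
  \<open>snd p\<close>.\<close>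

definition partial_ones :: "nat \<times> nat \<Rightarrow> nat \<Rightarrow> nat \<Rightarrow> 'a::field" where
  "partial_ones p t i = (if t = fst p \<and> i \<le> snd p then 1 else 0)"

lemma slope_partial_ones: "slope p (partial_ones q) = (if p = q then 1 else 0)"
  by (cases p; cases q) (auto simp: slope_def partial_ones_def)

lemma \<omega>_column_sum:
  assumes "t < k" and "finite I"
  shows "\<omega> (x(t := \<lambda>j. \<Sum>i\<in>I. c i * v i j)) = (\<Sum>i\<in>I. c i * \<omega> (x(t := v i)))"
  using assms(2)
proof (induction I rule: finite_induct)
  case empty
  then show ?case by (simp only: sum.empty \<omega>_zero[OF assms(1)])
next
  case (insert i I)
  have "\<omega> (x(t := \<lambda>j. \<Sum>i\<in>insert i I. c i * v i j)) =
      \<omega> (x(t := \<lambda>j. (\<Sum>i\<in>I. c i * v i j) + c i * v i j))"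
    using insert.hyps by (simp add: add.commute)
  also have "\<dots> = \<omega> (x(t := \<lambda>j. \<Sum>i\<in>I. c i * v i j)) + c i * \<omega> (x(t := v i))"
    by (rule \<omega>_linear[OF assms(1)])
  finally show ?case by (simp only: insert.IH sum.insert[OF insert.hyps] add.commute)
qed

text \<open>Each column of z is the combination of the \<open>partial_ones\<close> with its slopes
  as coefficients, plus a constant, which \<omega> does not see.\<close>

lemma polar_1_expand:
  "polar 1 x z =
    (\<Sum>p\<in>slots. \<omega> (x(fst p := partial_ones p (fst p))) * slope p z)"
proof -
  have "\<omega> (x(t := z t)) = (\<Sum>i<n - 1. \<omega> (x(t := partial_ones (t, i) t)) * slope (t, i) z)" if t: "t < k" for t
  proof -
    have "\<omega> (x(t := z t)) =
        \<omega> (x(t := \<lambda>j. (\<Sum>i<n - 1. slope (t, i) z * partial_ones (t, i) t j) + z t (n - 1) * 1))"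
    proof (intro \<omega>_cong)
      fix s j assume "j < n"
      then have j: "j \<le> n - 1" by simp
      have "(\<Sum>i<n - 1. slope (t, i) z * partial_ones (t, i) t j) = (\<Sum>i\<in>{j..<n - 1}. slope (t, i) z)"
        by (intro sum.mono_neutral_cong_right) (auto simp: partial_ones_def)
      then show "(x(t := z t)) s j =
          (x(t := \<lambda>j. (\<Sum>i<n - 1. slope (t, i) z * partial_ones (t, i) t j) + z t (n - 1) * 1)) s j"
        using telescope[OF j, of z t] by (simp add: algebra_simps)
    qed
    also have "\<dots> = \<omega> (x(t := \<lambda>j. \<Sum>i<n - 1. slope (t, i) z * partial_ones (t, i) t j)) +
        z t (n - 1) * \<omega> (x(t := \<lambda>_. 1))"
      by (rule \<omega>_linear[OF t])
    also have "\<dots> = (\<Sum>i<n - 1. slope (t, i) z * \<omega> (x(t := partial_ones (t, i) t)))"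
      by (simp only: \<omega>_one[OF t] \<omega>_column_sum[OF t finite_lessThan]) simp
    finally show ?thesis by (simp only: mult.commute)
  qed
  then have "polar 1 x z =
      (\<Sum>t<k. \<Sum>i<n - 1. \<omega> (x(t := partial_ones (t, i) t)) * slope (t, i) z)"
    unfolding polar_1 by (intro sum.cong) auto
  also have "\<dots> = (\<Sum>p\<in>slots. \<omega> (x(fst p := partial_ones p (fst p))) * slope p z)"
    unfolding slots_def by (simp add: sum.cartesian_product split_def)
  finally show ?thesis .
qed

text \<open>A choice of matrix at which the differential of \<open>\<omega>\<close> is the coordinate \<open>slope p\<close>.\<close>

definition probe :: "nat \<times> nat \<Rightarrow> nat \<Rightarrow> nat \<Rightarrow> 'a::field" where
  "probe p = (SOME x. x (fst p) = (\<lambda>_. 0) \<and>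
    (\<forall>y. \<omega> (x(fst p := y)) = y (snd p) - y (Suc (snd p))))"

lemma polar_1_probe:
  fixes z :: "nat \<Rightarrow> nat \<Rightarrow> 'a::field"
  assumes "p \<in> slots"
  shows "polar 1 (probe p) z = slope p z"
proof -
  obtain t i where p: "p = (t, i)" "t < k" "Suc i < n" using assms by (auto simp: slots_def)
  have "probe p t = (\<lambda>_. 0 :: 'a) \<and> (\<forall>y :: nat \<Rightarrow> 'a. \<omega> ((probe p)(t := y)) = y i - y (Suc i))"
    using someI_ex[OF dual_column[OF p(2,3), where 'a = 'a]] unfolding probe_def p(1) by simp
  then have pr: "probe p t = (\<lambda>_. 0 :: 'a)" "\<And>y :: nat \<Rightarrow> 'a. \<omega> ((probe p)(t := y)) = y i - y (Suc i)" by blast+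
  have "polar 1 (probe p) z = (\<Sum>s\<in>{t}. \<omega> ((probe p)(s := z s)))"
    unfolding polar_1
  proof (intro sum.mono_neutral_right ballI)
    fix s assume s: "s \<in> {..<k} - {t}"
    then have "(probe p)(s := z s) = ((probe p)(s := z s))(t := \<lambda>_. 0)"
      using pr(1) by (intro fun_upd_idem[symmetric]) auto
    then show "\<omega> ((probe p)(s := z s)) = 0" using \<omega>_zero[OF p(2)] by metis
  qed (use p in auto)
  then show ?thesis using pr(2) p(1) by (simp add: slope_def)
qed

end

section \<open>Linearity and bijectivity modulo equal rows\<close>

locale cullis_pair = cullis_form n k for n k +
  fixes f g :: "(nat \<Rightarrow> nat \<Rightarrow> 'a::field) \<Rightarrow> nat \<Rightarrow> nat \<Rightarrow> 'a"
  assumes large_field: "infinite (UNIV :: 'a set) \<or> card (UNIV :: 'a set) > k"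
    and preserve: "\<omega> (\<lambda>t i. x t i + c * z t i) = \<omega> (\<lambda>t i. f x t i + c * g z t i)"
begin

lemma polar_preserve:
  assumes "r \<le> k"
  shows "polar r (f x) (g z) = polar r x z"
proof (rule power_sum_coeffs_eq[OF large_field _ assms])
  show "(\<Sum>r\<le>k. c ^ r * polar r (f x) (g z)) = (\<Sum>r\<le>k. c ^ r * polar r x z)" for c
    using preserve[of x c z] by (simp only: \<omega>_combination)
qed

text \<open>The second equation is the coefficient of c^(k - 1): complementing the column sets
  exchanges base point and direction.\<close>

lemma polar_1_preserve: "polar 1 (f x) (g z) = polar 1 x z" "polar 1 (g z) (f x) = polar 1 z x"
proof -
  have "1 \<le> k" "k - 1 \<le> k" using k_ge by auto
  then show "polar 1 (f x) (g z) = polar 1 x z" "polar 1 (g z) (f x) = polar 1 z x"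
    using polar_preserve[of 1 x z] polar_preserve[of "k - 1" x z]
      polar_complement[of 1 "f x" "g z"] polar_complement[of 1 x z] by auto
qed

lemma \<omega>_preserve: "\<omega> (g z) = \<omega> z"
  using polar_preserve[of k z z] by (simp add: polar_top)

definition forward :: "nat \<times> nat \<Rightarrow> nat \<times> nat \<Rightarrow> 'a" where
  "forward b a = slope b (g (partial_ones a))"

text \<open>The differential of \<omega> at \<open>f (probe a)\<close>, written in slope
  coordinates.\<close>

definition backward :: "nat \<times> nat \<Rightarrow> nat \<times> nat \<Rightarrow> 'a" where
  "backward a b = \<omega> ((f (probe a))(fst b := partial_ones b (fst b)))"

lemma backward_slope:
  assumes "a \<in> slots"
  shows "(\<Sum>b\<in>slots. backward a b * slope b (g z)) = slope a z"
  using polar_1_preserve(1)[of "probe a" z] polar_1_expand[of "f (probe a)" "g z"]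
    polar_1_probe[OF assms, of z] unfolding backward_def by simp

text \<open>\<open>backward_slope\<close> at the dual basis gives the product in the other order.
  Both matrices are indexed by \<open>slots\<close>, so they are square and the inverse is
  two-sided.\<close>

lemma forward_backward:
  assumes "a \<in> slots" "b \<in> slots"
  shows "(\<Sum>c\<in>slots. forward a c * backward c b) = (if a = b then 1 else 0)"
proof (rule sum_mult_left_right_inverse[OF finite_slots _ assms])
  fix a b assume "a \<in> slots" "b \<in> slots"
  then show "(\<Sum>c\<in>slots. backward a c * forward c b) = (if a = b then 1 else 0)"
    using backward_slope[of a "partial_ones b"] by (simp add: forward_def slope_partial_ones)
qed

lemma forward_backward_apply:
  assumes "b \<in> slots"
  shows "(\<Sum>a\<in>slots. forward b a * (\<Sum>c\<in>slots. backward a c * q c)) = q b"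
proof -
  have "(\<Sum>a\<in>slots. forward b a * (\<Sum>c\<in>slots. backward a c * q c)) =
      (\<Sum>c\<in>slots. (\<Sum>a\<in>slots. forward b a * backward a c) * q c)"
    by (simp add: sum_distrib_left sum_distrib_right mult.assoc) (rule sum.swap)
  also have "\<dots> = (\<Sum>c\<in>slots. if b = c then q c else 0)"
    using assms by (intro sum.cong) (auto simp: forward_backward)
  finally show ?thesis using assms by simp
qed

text \<open>Inverting \<open>backward_slope\<close> yields linearity of g in slope
  coordinates.\<close>

lemma slope_g:
  assumes "b \<in> slots"
  shows "slope b (g z) = (\<Sum>a\<in>slots. forward b a * slope a z)"
proof -
  have "(\<Sum>a\<in>slots. forward b a * slope a z) =
      (\<Sum>a\<in>slots. forward b a * (\<Sum>c\<in>slots. backward a c * slope c (g z)))"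
    by (intro sum.cong) (auto simp: backward_slope)
  then show ?thesis using forward_backward_apply[OF assms, of "\<lambda>c. slope c (g z)"] by simp
qed

definition T :: "(nat \<Rightarrow> nat \<Rightarrow> 'a) \<Rightarrow> nat \<Rightarrow> nat \<Rightarrow> 'a" where
  "T x = normalize_rows (g x)"

lemma T_linear: "T (\<lambda>t i. x t i + c * z t i) = (\<lambda>t i. T x t i + c * T z t i)"
  unfolding T_def normalize_rows_linear[symmetric] normalize_rows_eq_iff
  by (simp add: slope_g slope_linear sum.distrib sum_distrib_left algebra_simps)

lemma normalize_rows_T [simp]: "normalize_rows (T x) = T x"
  by (simp add: T_def)

lemma T_eqD: "T x = T z \<Longrightarrow> normalize_rows x = normalize_rows z"
  unfolding T_def normalize_rows_eq_iff by (metis (no_types, lifting) backward_slope sum.cong)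

lemma T_normalize_rows: "T (normalize_rows x) = T x"
proof -
  have "slope p (normalize_rows x) = slope p x" if "p \<in> slots" for p
    using that normalize_rows_eq_iff[of "normalize_rows x" x] by simp
  then show ?thesis unfolding T_def normalize_rows_eq_iff by (simp add: slope_g)
qed

lemma T_surj:
  assumes "normalize_rows y = y"
  shows "\<exists>x. normalize_rows x = x \<and> T x = y"
proof -
  define e where "e a = (\<Sum>b\<in>slots. backward a b * slope b y)" for a
  \<comment> \<open>Tail sums have the prescribed consecutive differences.\<close>
  define x where "x t j = (\<Sum>i\<in>{j..<n - 1}. e (t, i))" for t j
  have "slope a x = e a" if "a \<in> slots" for a
    using that by (auto simp: slots_def slope_def x_def sum.atLeast_Suc_lessThan)
  then have "slope b (g x) = slope b y" if "b \<in> slots" for b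
    using that forward_backward_apply[OF that, of "\<lambda>c. slope c y"] by (simp add: slope_g e_def)
  then have "T x = normalize_rows y" unfolding T_def normalize_rows_eq_iff by simp
  then show ?thesis using assms T_normalize_rows[of x] by (intro exI[of _ "normalize_rows x"]) simp
qed

lemma T_polar:
  assumes "r \<le> k"
  shows "polar r (T x) (T z) = polar r x z"
proof (rule power_sum_coeffs_eq[OF large_field _ assms])
  fix c
  have "\<omega> (\<lambda>t i. T x t i + c * T z t i) = \<omega> (\<lambda>t i. x t i + c * z t i)"
    unfolding T_linear[symmetric] by (simp add: T_def \<omega>_preserve)
  then show "(\<Sum>r\<le>k. c ^ r * polar r (T x) (T z)) = (\<Sum>r\<le>k. c ^ r * polar r x z)"
    by (simp only: \<omega>_combination)
qed

text \<open>Against every \<open>g z\<close>, both \<open>f x\<close> and \<open>g x\<close> have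
  the linear coefficient \<open>polar 1 z x\<close>. By surjectivity \<open>g z\<close> may be
  congruent to \<open>probe p\<close>, where this coefficient reads off
  \<open>slope p\<close>.\<close>

lemma normalize_rows_f: "normalize_rows (f x) = T x"
proof -
  have *: "polar 1 (probe p) h = polar 1 (g z) h" if "T z = normalize_rows (probe p)" for p z h
  proof -
    have "polar 1 (probe p) h = polar 1 (normalize_rows (probe p)) (normalize_rows h)"
      by (rule polar_normalize_rows[symmetric])
    also have "\<dots> = polar 1 (g z) h" unfolding that[symmetric] T_def by (rule polar_normalize_rows)
    finally show ?thesis .
  qed
  have "slope p (f x) = slope p (g x)" if p: "p \<in> slots" for p
  proof -
    obtain z where z: "T z = normalize_rows (probe p)"
      using T_surj[of "normalize_rows (probe p)"] by auto
    have "1 \<le> k" using k_ge by simp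
    then have "polar 1 (g z) (g x) = polar 1 z x"
      using T_polar[of 1 z x] by (simp add: T_def)
    then show ?thesis
      using *[OF z, of "f x"] *[OF z, of "g x"] polar_1_preserve(2)[of z x]
        polar_1_probe[OF p, of "f x"] polar_1_probe[OF p, of "g x"] by simp
  qed
  then show ?thesis unfolding T_def normalize_rows_eq_iff by simp
qed

end

lemma underdetermined_system:
  fixes M :: "nat \<Rightarrow> nat \<Rightarrow> 'a::field"
  assumes "k < m"
  shows "\<exists>x. (\<exists>i<m. x i \<noteq> 0) \<and> (\<forall>t<k. (\<Sum>i<m. x i * M t i) = 0)"
proof -
  \<comment> \<open>Zero rows pad the system to a square one; row k exists and is zero because k <
    m, so the determinant vanishes.\<close>
  define A where "A = mat m m (\<lambda>(t, i). if t < k then M t i else 0)"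
  have A: "A \<in> carrier_mat m m" by (simp add: A_def)
  have "A = mat\<^sub>r m m (\<lambda>t. if t = k then 0\<^sub>v m else row A t)"
    by (intro eq_matI) (auto simp: A_def)
  then have "det A = det (mat\<^sub>r m m (\<lambda>t. if t = k then 0\<^sub>v m else row A t))" by simp
  also have "\<dots> = 0" using assms A by (intro det_row_0) auto
  finally obtain v where v: "v \<in> carrier_vec m" "v \<noteq> 0\<^sub>v m" "A *\<^sub>v v = 0\<^sub>v m"
    using det_0_iff_vec_prod_zero_field[OF A] by blast
  have "\<exists>i<m. v $ i \<noteq> 0"
  proof (rule ccontr)
    assume "\<not> ?thesis"
    with v(1) have "v = 0\<^sub>v m" by (intro eq_vecI) auto
    with v(2) show False by simp
  qed
  moreover have "(\<Sum>i<m. v $ i * M t i) = 0" if "t < k" for t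
  proof -
    have "(A *\<^sub>v v) $ t = (\<Sum>i<m. v $ i * M t i)"
      using that assms v(1) by (simp add: A_def scalar_prod_def mult.commute atLeast0LessThan)
    then show ?thesis using v(3) that assms by simp
  qed
  ultimately show ?thesis by (intro exI[of _ "\<lambda>i. v $ i"]) blast
qed

section \<open>Matrices with pairwise perpendicular columns\<close>

context cullis_form
begin

text \<open>Phrased through \<open>polar 2\<close> so that invariance under \<open>T\<close> follows
  from \<open>T_polar\<close>; \<open>null_iff\<close> gives the meaning in terms of
  columns.\<close>

definition null :: "(nat \<Rightarrow> nat \<Rightarrow> 'a::field) \<Rightarrow> bool" where
  "null z \<longleftrightarrow> (\<forall>y. polar 2 y z = 0)"

lemma null_iff: "null z \<longleftrightarrow> (\<forall>s<k. \<forall>t<k. s \<noteq> t \<longrightarrow> perp (z s) (z t))"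
proof
  assume *: "\<forall>s<k. \<forall>t<k. s \<noteq> t \<longrightarrow> perp (z s) (z t)"
  show "null z" unfolding null_def polar_def
  proof (intro allI sum.neutral ballI)
    fix y S assume "S \<in> {S. S \<subseteq> {..<k} \<and> card S = 2}"
    then obtain s t where S: "S = {s, t}" "s < k" "t < k" "s \<noteq> t" by (auto simp: card_2_iff)
    then have "(\<lambda>r. if r \<in> S then z r else y r) = y(s := z s, t := z t)" by (intro ext) auto
    moreover have "perp (z s) (z t)" using * S by blast
    ultimately show "\<omega> (\<lambda>r. if r \<in> S then z r else y r) = 0" using perp_iff[OF S(2-4)] by metis
  qed
next
  assume null: "null z"
  show "\<forall>s<k. \<forall>t<k. s \<noteq> t \<longrightarrow> perp (z s) (z t)"
  proof (intro allI impI)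
    fix s t assume st: "s < k" "t < k" "s \<noteq> t"
    have "\<omega> (y(s := z s, t := z t)) = 0" for y
    proof -
      \<comment> \<open>With columns s and t of y cleared, {s, t} is the only pair whose term can be
        nonzero.\<close>
      define y' where "y' = y(s := \<lambda>_. 0, t := \<lambda>_. 0)"
      let ?g = "\<lambda>S r. if r \<in> S then z r else y' r"
      have "polar 2 y' z = (\<Sum>S\<in>{{s, t}}. \<omega> (?g S))"
        unfolding polar_def
      proof (intro sum.mono_neutral_right ballI)
        fix S assume S: "S \<in> {S. S \<subseteq> {..<k} \<and> card S = 2} - {{s, t}}"
        then have "card S = 2" "S \<noteq> {s, t}" "finite S" using finite_subset[of S "{..<k}"] by auto
        then have "\<not> {s, t} \<subseteq> S" using st card_subset_eq[of S "{s, t}"] by auto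
        then obtain r where r: "r \<in> {s, t}" "r \<notin> S" by blast
        then have "?g S r = (\<lambda>_. 0)" by (auto simp: y'_def)
        then have "(?g S)(r := \<lambda>_. 0) = ?g S" by (rule fun_upd_idem)
        moreover have "r < k" using r st by auto
        then have "\<omega> ((?g S)(r := \<lambda>_. 0)) = 0" by (rule \<omega>_zero)
        ultimately show "\<omega> (?g S) = 0" by (simp only:)
      qed (use st in auto)
      moreover have "?g {s, t} = y(s := z s, t := z t)" by (rule ext) (auto simp: y'_def)
      ultimately have "polar 2 y' z = \<omega> (y(s := z s, t := z t))" by (simp only: sum.insert sum.empty) simp
      then show ?thesis using null unfolding null_def by metis
    qed
    then show "perp (z s) (z t)" using perp_iff[OF st] by blast
  qed
qed

definition rank_one :: "(nat \<Rightarrow> 'a::field) \<Rightarrow> (nat \<Rightarrow> 'a) \<Rightarrow> nat \<Rightarrow> nat \<Rightarrow> 'a" where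
  "rank_one \<gamma> v t i = \<gamma> t * v i"

lemma perp_zero: "perp v (\<lambda>_. 0)" "perp (\<lambda>_. 0) v"
proof -
  have "k - 1 < k" using k_ge by simp
  then show "perp v (\<lambda>_. 0)" unfolding perp_def by (simp only: \<omega>_zero) simp
  then show "perp (\<lambda>_. 0) v" by (subst perp_commute)
qed

lemma perp_scale: "perp v w \<Longrightarrow> perp v (\<lambda>i. c * w i)"
  using perp_linear[OF perp_zero(1), of v w c] by simp

lemma perp_scale_iff: "c \<noteq> 0 \<Longrightarrow> perp v (\<lambda>i. c * w i) \<longleftrightarrow> perp v w"
  using perp_scale[of v w c] perp_scale[of v "\<lambda>i. c * w i" "1 / c"] by auto

lemma null_rank_one: "null (rank_one \<gamma> v)"
  unfolding null_iff
proof (intro allI impI)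
  fix s t
  have "perp (\<lambda>i. \<gamma> t * v i) (\<lambda>i. \<gamma> s * v i)"
    by (intro perp_scale) (subst perp_commute, intro perp_scale perp_self)
  then have "perp (\<lambda>i. \<gamma> s * v i) (\<lambda>i. \<gamma> t * v i)" by (subst perp_commute)
  moreover have "rank_one \<gamma> v r = (\<lambda>i. \<gamma> r * v i)" for r by (rule ext) (simp add: rank_one_def)
  ultimately show "perp (rank_one \<gamma> v s) (rank_one \<gamma> v t)" by simp
qed

lemma null_cong:
  assumes "\<And>t. t < k \<Longrightarrow> x t = z t"
  shows "null x \<longleftrightarrow> null z"
  unfolding null_iff using assms by auto

text \<open>Expand the contraction by columns 0 and t of z + w. The pure terms vanish as z and w are
  null, and the mixed ones combine, after a swap, to the contraction by v and the stated
  difference.\<close>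

lemma perp_of_null_sum:
  assumes z: "\<And>t. t < k \<Longrightarrow> z t = (\<lambda>i. \<gamma> t * v i)" and "\<gamma> 0 = 1" and "t < k" and w: "null w"
    and sum: "null (\<lambda>t i. z t i + w t i)"
  shows "perp v (\<lambda>i. w t i - \<gamma> t * w 0 i)"
proof (cases "t = 0")
  case True
  with \<open>\<gamma> 0 = 1\<close> show ?thesis using perp_zero(1)[of v] by simp
next
  case False
  have k: "0 < k" "t < k" "0 \<noteq> t" using k_ge \<open>t < k\<close> False by auto
  have z0: "z 0 = v" using z[OF k(1)] \<open>\<gamma> 0 = 1\<close> by simp
  have "\<omega> (y(0 := v, t := \<lambda>i. w t i + (- \<gamma> t) * w 0 i)) = 0" for y
  proof -
    let ?z = "z 0" and ?w = "w 0"
    let ?zt = "z t" and ?wt = "w t"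
    have twist: "y(0 := a, t := b) = y(t := b, 0 := a)" for a b using k(3) by (rule fun_upd_twist)
    have split0: "\<omega> (y(0 := \<lambda>i. ?z i + ?w i, t := b)) = \<omega> (y(0 := ?z, t := b)) + \<omega> (y(0 := ?w, t := b))" for b
      unfolding twist by (rule \<omega>_add[OF k(1)])
    have null_z: "null z"
      using null_rank_one[of \<gamma> v] null_cong[of z "rank_one \<gamma> v"] z by (auto simp: rank_one_def fun_eq_iff)
    have "0 = \<omega> (y(0 := \<lambda>i. ?z i + ?w i, t := \<lambda>i. ?zt i + ?wt i))"
      using sum perp_iff[OF k] k unfolding null_iff by metis
    also have "\<dots> = \<omega> (y(0 := ?z, t := ?zt)) + \<omega> (y(0 := ?w, t := ?zt)) +
        (\<omega> (y(0 := ?z, t := ?wt)) + \<omega> (y(0 := ?w, t := ?wt)))"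
      by (simp only: \<omega>_add[OF k(2)] split0)
    also have "\<omega> (y(0 := ?z, t := ?zt)) = 0"
      using null_z perp_iff[OF k] k unfolding null_iff by metis
    also have "\<omega> (y(0 := ?w, t := ?wt)) = 0"
      using w perp_iff[OF k] k unfolding null_iff by metis
    also have "\<omega> (y(0 := ?w, t := ?zt)) = \<gamma> t * \<omega> (y(0 := ?w, t := v))"
      unfolding z[OF k(2)] by (rule \<omega>_scale[OF k(2)])
    also have "\<omega> (y(0 := ?w, t := v)) = - \<omega> (y(0 := v, t := ?w))" by (rule \<omega>_swap[OF k])
    finally have "0 = 0 + \<gamma> t * - \<omega> (y(0 := v, t := ?w)) + (\<omega> (y(0 := v, t := ?wt)) + 0)"
      unfolding z0 .
    moreover have "0 = 0 + g * - q + (p + 0) \<Longrightarrow> p + (- g) * q = 0" for g p q :: 'a by simp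
    ultimately show ?thesis unfolding \<omega>_linear[OF k(2)] by blast
  qed
  then have "perp v (\<lambda>i. w t i + (- \<gamma> t) * w 0 i)" using perp_iff[OF k] by blast
  then show ?thesis by simp
qed

definition supported :: "(nat \<Rightarrow> 'a::field) \<Rightarrow> bool" where
  "supported v \<longleftrightarrow> (\<forall>i\<ge>n - 1. v i = 0)"

text \<open>Both vectors vanish in row n - 1, which rules out an additive constant.\<close>

lemma perp_supported:
  assumes "perp v w" and "test_fun v \<noteq> 0" and "supported v" "supported w"
  shows "\<exists>c. w = (\<lambda>i. c * v i)"
proof -
  obtain c d where cd: "\<And>i. i < n \<Longrightarrow> w i = c * v i + d"
    using perp_imp_proportional[OF assms(1,2)] by blast
  have "d = 0" using cd[of "n - 1"] assms(3,4) n_ge by (simp add: supported_def)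
  then have "w i = c * v i" for i
    using cd[of i] assms(3,4) by (cases "i < n - 1") (auto simp: supported_def)
  then show ?thesis by blast
qed

lemma test_fun_unit: "test_fun (unit_fun (k - 3)) \<noteq> (0 :: 'a::field)"
proof -
  have "test_fun (unit_fun (k - 3)) = (\<Sum>a\<in>{k - 3}. (- 1 :: 'a) ^ a * unit_fun (k - 3) a)"
    unfolding test_fun_def using n_ge by (intro sum.mono_neutral_right) auto
  then show ?thesis by simp
qed

lemma supported_unit: "i < n - 1 \<Longrightarrow> supported (unit_fun i)"
  by (auto simp: supported_def)

lemma ex_not_perp: "\<exists>v w :: nat \<Rightarrow> 'a::field. \<not> perp v w"
proof (rule ccontr)
  assume "\<not> ?thesis"
  then have "perp (unit_fun (k - 3) :: nat \<Rightarrow> 'a) (unit_fun (k - 2))" by blast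
  moreover have "supported (unit_fun (k - 3) :: nat \<Rightarrow> 'a)" "supported (unit_fun (k - 2) :: nat \<Rightarrow> 'a)"
    using n_ge k_ge by (auto intro!: supported_unit)
  ultimately obtain c :: 'a where "unit_fun (k - 2) = (\<lambda>i. c * unit_fun (k - 3) i)"
    using perp_supported test_fun_unit by blast
  moreover have "k - 2 \<noteq> k - 3" using k_ge by arith
  ultimately show False by (auto dest: fun_cong[of _ _ "k - 2"])
qed

text \<open>The factors of \<open>L (x\<^sub>0 + c x)\<close> for \<open>c = 0, 1, e\<close> are affine in \<open>c\<close> and coincide for
  \<open>c = 1\<close> and \<open>c = e\<close>, hence are all equal.\<close>

lemma pointwise_proportional:
  fixes A L :: "(nat \<Rightarrow> 'a::field) \<Rightarrow> nat \<Rightarrow> 'a" and e :: 'a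
  assumes A: "\<And>x y c. A (\<lambda>i. x i + c * y i) = (\<lambda>i. A x i + c * A y i)"
    and L: "\<And>x y c. L (\<lambda>i. x i + c * y i) = (\<lambda>i. L x i + c * L y i)"
    and e: "e \<noteq> 0" "e \<noteq> 1"
    and x0: "test_fun (A x0) \<noteq> 0"
    and along: "\<And>x. test_fun (A x) \<noteq> 0 \<Longrightarrow> \<exists>c. L x = (\<lambda>i. c * A x i)"
    and ker: "\<And>x. A x = (\<lambda>_. 0) \<Longrightarrow> L x = (\<lambda>_. 0)"
  shows "\<exists>c. \<forall>x. L x = (\<lambda>i. c * A x i)"
proof -
  obtain h0 where h0: "L x0 = (\<lambda>i. h0 * A x0 i)" using along[OF x0] by blast
  have kernel: "L x = (\<lambda>i. h0 * A x i)" if x: "test_fun (A x) = 0" for x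
  proof (cases "A x = (\<lambda>_. 0)")
    case True
    with ker[OF True] show ?thesis by simp
  next
    case False
    then obtain j where j: "A x j \<noteq> 0" by auto
    have "\<exists>h. L (\<lambda>i. x0 i + c * x i) = (\<lambda>i. h * (A x0 i + c * A x i))" for c
      using along[of "\<lambda>i. x0 i + c * x i"] x0 x unfolding A test_fun_linear by simp
    then obtain h where "\<And>c. L (\<lambda>i. x0 i + c * x i) = (\<lambda>i. h c * (A x0 i + c * A x i))" by metis
    then have h: "h0 * A x0 i + c * L x i = h c * (A x0 i + c * A x i)" for c i
      unfolding L h0 by meson
    have Lx: "L x i = (h 1 - h0) * A x0 i + h 1 * A x i" for i
      using h[of i 1] by (simp add: algebra_simps)
    \<comment> \<open>p and q are the coefficients of \<open>A x0\<close> and \<open>A x\<close> in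
      the equation for c = e, after L x is eliminated by the one for c = 1. \<open>test_fun\<close>
      isolates p, and then a nonzero entry of \<open>A x\<close> isolates q.\<close>
    define p where "p = h0 + e * (h 1 - h0) - h e"
    define q where "q = e * (h 1 - h e)"
    have pq: "p * A x0 i + q * A x i = 0" for i
      using h[of i e] unfolding Lx p_def q_def by (simp add: algebra_simps)
    have "0 = p * test_fun (A x0) + q * test_fun (A x)"
      using test_fun_linear[of "\<lambda>i. p * A x0 i" q "A x"] test_fun_linear[of "\<lambda>_. 0" p "A x0"]
      by (simp add: pq test_fun_def)
    with x x0 have p: "p = 0" by simp
    with pq[of j] j e have "h 1 = h e" by (simp add: q_def)
    with p have "(1 - e) * (h 1 - h0) = 0" by (simp add: p_def algebra_simps)
    with e have "h 1 = h0" by simp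
    then show ?thesis by (intro ext) (simp add: Lx)
  qed
  have "L x = (\<lambda>i. h0 * A x i)" for x
  proof -
    define a where "a = test_fun (A x) / test_fun (A x0)"
    define x' where "x' = (\<lambda>i. x i + (- a) * x0 i)"
    have "test_fun (A x') = 0" unfolding x'_def A test_fun_linear using x0 by (simp add: a_def)
    from kernel[OF this] have "L x i + (- a) * L x0 i = h0 * (A x i + (- a) * A x0 i)" for i
      unfolding x'_def A L by meson
    then show ?thesis unfolding h0 by (intro ext) (simp add: algebra_simps)
  qed
  then show ?thesis by blast
qed

end

section \<open>Images of rank one matrices\<close>

context cullis_pair
begin

lemma null_T: "null (T z) \<longleftrightarrow> null z"
proof
  have k2: "2 \<le> k" using k_ge by simp
  show "null z" if "null (T z)"
    using that T_polar[OF k2] unfolding null_def by metis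
  \<comment> \<open>Here y ranges over all matrices, so it is first replaced by some
    \<open>T x\<close>, using surjectivity.\<close>
  show "null (T z)" if "null z"
    unfolding null_def
  proof
    fix y
    obtain x where x: "T x = normalize_rows y" using T_surj[of "normalize_rows y"] by auto
    have "polar 2 y (T z) = polar 2 (normalize_rows y) (normalize_rows (T z))"
      by (rule polar_normalize_rows[symmetric])
    also have "\<dots> = polar 2 x z" unfolding x[symmetric] normalize_rows_T by (rule T_polar[OF k2])
    finally show "polar 2 y (T z) = 0" using that by (simp add: null_def)
  qed
qed

lemma T_cong:
  assumes "\<And>t i. t < k \<Longrightarrow> i < n \<Longrightarrow> x t i = y t i"
  shows "T x = T y"
proof -
  have "normalize_rows x = normalize_rows y"
    unfolding normalize_rows_def using assms n_ge by (intro ext) auto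
  then show ?thesis using T_normalize_rows by metis
qed

lemma T_zero: "T (\<lambda>_ _. 0) = (\<lambda>_ _. 0)"
  using T_linear[of "\<lambda>_ _. 0" "- 1" "\<lambda>_ _. 0"] by simp

lemma T_sum:
  assumes "finite I"
  shows "T (\<lambda>t i. \<Sum>s\<in>I. c s * x s t i) = (\<lambda>t i. \<Sum>s\<in>I. c s * T (x s) t i)"
  using assms
proof (induction I rule: finite_induct)
  case empty
  then show ?case by (simp only: sum.empty T_zero)
next
  case (insert s I)
  have "T (\<lambda>t i. \<Sum>s\<in>insert s I. c s * x s t i) = T (\<lambda>t i. (\<Sum>s\<in>I. c s * x s t i) + c s * x s t i)"
    by (simp only: sum.insert[OF insert.hyps] add.commute)
  also have "\<dots> = (\<lambda>t i. T (\<lambda>t i. \<Sum>s\<in>I. c s * x s t i) t i + c s * T (x s) t i)"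
    by (rule T_linear)
  finally show ?case by (simp only: insert.IH sum.insert[OF insert.hyps] add.commute)
qed

definition block :: "nat \<Rightarrow> (nat \<Rightarrow> 'a) \<Rightarrow> nat \<Rightarrow> nat \<Rightarrow> 'a" where
  "block s v = T (rank_one (unit_fun s) v)"

lemma block_linear:
  "block s (\<lambda>i. v i + c * w i) = (\<lambda>t i. block s v t i + c * block s w t i)"
  unfolding block_def T_linear[symmetric]
  by (intro arg_cong[of _ _ T]) (auto simp: rank_one_def fun_eq_iff algebra_simps)

lemma block_sum:
  assumes "finite I"
  shows "block s (\<lambda>i. \<Sum>j\<in>I. c j * v j i) = (\<lambda>t i. \<Sum>j\<in>I. c j * block s (v j) t i)"
  unfolding block_def T_sum[OF assms, symmetric]
  by (intro arg_cong[of _ _ T]) (auto simp: rank_one_def fun_eq_iff sum_distrib_left mult.left_commute)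

lemma T_blocks: "T x = (\<lambda>t i. \<Sum>s<k. block s (x s) t i)"
proof -
  have "T x = T (\<lambda>t i. \<Sum>s<k. 1 * rank_one (unit_fun s) (x s) t i)"
  proof (intro T_cong)
    fix t i assume "t < k"
    have "(\<Sum>s<k. 1 * rank_one (unit_fun s) (x s) t i) = (\<Sum>s<k. if s = t then x t i else 0)"
      by (intro sum.cong) (auto simp: rank_one_def)
    with \<open>t < k\<close> show "x t i = (\<Sum>s<k. 1 * rank_one (unit_fun s) (x s) t i)" by simp
  qed
  also have "\<dots> = (\<lambda>t i. \<Sum>s<k. 1 * block s (x s) t i)"
    unfolding block_def by (rule T_sum) simp
  finally show ?thesis by simp
qed

lemma supported_T: "t < k \<Longrightarrow> supported (T x t)"
  by (auto simp: supported_def T_def normalize_rows_def)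

lemma supported_block: "t < k \<Longrightarrow> supported (block s x t)"
  unfolding block_def by (rule supported_T)

lemma null_block: "null (block s v)"
  unfolding block_def null_T by (rule null_rank_one)

lemma null_block_sum_same_slot: "null (\<lambda>t i. block s v t i + block s w t i)"
  using null_block[of s "\<lambda>i. v i + 1 * w i"] unfolding block_linear by simp

lemma null_block_sum_same_vector: "null (\<lambda>t i. block r v t i + block s v t i)"
proof -
  have "(\<lambda>t i. block r v t i + 1 * block s v t i) = T (rank_one (\<lambda>t. unit_fun r t + unit_fun s t) v)"
    unfolding block_def T_linear[symmetric]
    by (intro arg_cong[of _ _ T]) (auto simp: rank_one_def fun_eq_iff algebra_simps)
  then show ?thesis using null_T[of "rank_one (\<lambda>t. unit_fun r t + unit_fun s t) v"] null_rank_one by simp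
qed

lemma block_kernel:
  assumes "s < k" and "block s x = (\<lambda>_ _. 0)" and "i < n - 1"
  shows "x i = x (n - 1)"
proof -
  have "T (rank_one (unit_fun s) x) = T (\<lambda>_ _. 0)" using assms(2) by (simp add: block_def T_zero)
  then have "normalize_rows (rank_one (unit_fun s) x) s i = normalize_rows (\<lambda>_ _. 0) s i"
    using T_eqD by metis
  then show ?thesis using assms by (simp add: normalize_rows_def rank_one_def)
qed

lemma block_outside: "\<not> t < k \<Longrightarrow> block s x t = (\<lambda>_. 0)"
  by (auto simp: block_def T_def normalize_rows_def)

text \<open>Otherwise column 0 of every \<open>T x\<close>, being a sum of columns 0 of blocks,
  would lie in the kernel of \<open>test_fun\<close>, against surjectivity.\<close>

lemma ex_good_block: "\<exists>s<k. \<exists>x. test_fun (block s x 0) \<noteq> 0"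
proof (rule ccontr)
  assume *: "\<not> ?thesis"
  define y :: "nat \<Rightarrow> nat \<Rightarrow> 'a" where "y = rank_one (unit_fun 0) (unit_fun (k - 3))"
  have y0: "y 0 = unit_fun (k - 3)" by (auto simp: y_def rank_one_def)
  have "normalize_rows y = y"
    using k_ge n_ge by (auto simp: y_def rank_one_def normalize_rows_def fun_eq_iff)
  then obtain x where "T x = y" using T_surj by blast
  then have y: "y = (\<lambda>t i. \<Sum>s<k. block s (x s) t i)" using T_blocks by metis
  have "test_fun (y 0) = test_fun (\<lambda>i. \<Sum>s<k. block s (x s) 0 i)"
    by (subst y) (rule refl)
  also have "\<dots> = (\<Sum>s<k. test_fun (block s (x s) 0))"
    unfolding test_fun_def sum_distrib_left by (rule sum.swap)
  also have "\<dots> = 0" using * by (intro sum.neutral) auto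
  finally show False unfolding y0 using test_fun_unit by blast
qed

lemma supported_expand:
  assumes "supported v"
  shows "v = (\<lambda>i. \<Sum>j<n - 1. v j * unit_fun j i)"
proof
  fix i
  have "(\<Sum>j<n - 1. v j * unit_fun j i) = (\<Sum>j<n - 1. if j = i then v i else 0)"
    by (intro sum.cong) auto
  then show "v i = (\<Sum>j<n - 1. v j * unit_fun j i)"
    using assms by (auto simp: supported_def)
qed

text \<open>Matrices with all columns on one line form a space of dimension at most k < n - 1,
  whereas \<open>block s\<close> is injective modulo constants.\<close>

lemma block_not_in_line:
  assumes "s < k"
  shows "\<not> (\<forall>x. \<forall>t<k. \<exists>c. block s x t = (\<lambda>i. c * v i))"
proof
  assume *: "\<forall>x. \<forall>t<k. \<exists>c. block s x t = (\<lambda>i. c * v i)"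
  have "k < n - 1" using n_ge parity by presburger
  then obtain x j where x: "j < n - 1" "x j \<noteq> 0" and
    sys: "\<And>t l. t < k \<Longrightarrow> (\<Sum>i<n - 1. x i * (SOME c. block s (unit_fun i) t = (\<lambda>i. c * v i))) = 0"
    using underdetermined_system[of k "n - 1" "\<lambda>t i. SOME c. block s (unit_fun i) t = (\<lambda>i. c * v i)"]
    by blast
  define x' where "x' = (\<lambda>i. if i < n - 1 then x i else 0)"
  have "block s x' t l = 0" for t l
  proof (cases "t < k")
    case t: True
    define c where "c i = (SOME c. block s (unit_fun i) t = (\<lambda>i. c * v i))" for i
    have "\<exists>c. block s (unit_fun i) t = (\<lambda>i. c * v i)" for i using * t by blast
    then have c: "block s (unit_fun i) t = (\<lambda>l. c i * v l)" for i
      unfolding c_def by (rule someI_ex)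
    have "supported x'" by (auto simp: x'_def supported_def)
    from supported_expand[OF this] have "block s x' t l = (\<Sum>i<n - 1. x' i * block s (unit_fun i) t l)"
      using block_sum[OF finite_lessThan, of s x' unit_fun "n - 1"] by metis
    also have "\<dots> = (\<Sum>i<n - 1. x i * c i) * v l"
      unfolding c sum_distrib_right by (intro sum.cong) (auto simp: x'_def)
    also have "\<dots> = 0" using sys[OF t] unfolding c_def by simp
    finally show ?thesis .
  qed (simp add: block_outside)
  then have "block s x' = (\<lambda>_ _. 0)" by blast
  from block_kernel[OF assms this x(1)] x show False by (simp add: x'_def)
qed

lemma block_factor:
  assumes s: "s < k" and x0: "test_fun (block s x0 0) \<noteq> 0"
  shows "\<exists>\<gamma>. \<gamma> 0 = 1 \<and> (\<forall>x. \<forall>t<k. block s x t = (\<lambda>i. \<gamma> t * block s x 0 i))"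
proof -
  define v where "v = block s x0 0"
  have k0: "0 < k" using k_ge by simp
  have v: "test_fun v \<noteq> 0" "supported v" using x0 supported_block[OF k0] by (auto simp: v_def)
  have line: "\<exists>c. w = (\<lambda>i. c * v i)" if "perp v w" "supported w" for w
    using perp_supported[OF that(1) v(1) v(2) that(2)] .
  have "\<exists>c. block s x0 t = (\<lambda>i. c * v i) \<and> (t = 0 \<longrightarrow> c = 1)" if t: "t < k" for t
  proof (cases "t = 0")
    case False
    then have "perp v (block s x0 t)"
      using null_block[of s x0] k0 t unfolding null_iff v_def by auto
    with False line supported_block[OF t] show ?thesis by blast
  qed (auto simp: v_def)
  then obtain \<gamma> where \<gamma>: "\<And>t. t < k \<Longrightarrow> block s x0 t = (\<lambda>i. \<gamma> t * v i)" "\<gamma> 0 = 1"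
    using k0 by metis
  \<comment> \<open>P says that x has the same row factor as x0, Q that column 0 of its image lies
    on the line of v. Both are subspaces and together cover everything, so one of them is
    everything; for Q this contradicts \<open>block_not_in_line\<close>.\<close>
  define P where "P x \<longleftrightarrow> (\<forall>t<k. block s x t = (\<lambda>i. \<gamma> t * block s x 0 i))" for x
  define Q where "Q x \<longleftrightarrow> (\<exists>c. block s x 0 = (\<lambda>i. c * v i))" for x
  have diff: "\<exists>c. block s x t = (\<lambda>i. \<gamma> t * block s x 0 i + c * v i)" if t: "t < k" for x t
  proof -
    have "perp v (\<lambda>i. block s x t i - \<gamma> t * block s x 0 i)"
      by (rule perp_of_null_sum[OF \<gamma>(1) \<gamma>(2) t null_block null_block_sum_same_slot])
    moreover have "supported (\<lambda>i. block s x t i - \<gamma> t * block s x 0 i)"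
      using supported_block[OF t, of s x] supported_block[OF k0, of s x] by (simp add: supported_def)
    ultimately obtain c where "(\<lambda>i. block s x t i - \<gamma> t * block s x 0 i) = (\<lambda>i. c * v i)"
      using line by blast
    then have "block s x t i = \<gamma> t * block s x 0 i + c * v i" for i
      by (metis add.commute diff_add_cancel)
    then show ?thesis by blast
  qed
  have PQ: "P x \<or> Q x" for x
  proof (rule disjCI)
    assume "\<not> Q x"
    show "P x" unfolding P_def
    proof (intro allI impI)
      fix t assume t: "t < k"
      obtain c where c: "block s x t = (\<lambda>i. \<gamma> t * block s x 0 i + c * v i)" using diff[OF t] by blast
      \<comment> \<open>If c is nonzero, c v is a combination of columns t and 0 of a null matrix,
        so v is perpendicular to column 0, which then lies on the line of v.\<close>
      have "c = 0"
      proof (rule ccontr)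
        assume "c \<noteq> 0"
        have "perp (block s x 0) (block s x t)"
          using null_block[of s x] k0 t perp_self unfolding null_iff by (cases "t = 0") auto
        then have "perp (block s x 0) (\<lambda>i. block s x t i + (- \<gamma> t) * block s x 0 i)"
          by (intro perp_linear perp_self)
        then have "perp (block s x 0) (\<lambda>i. c * v i)" unfolding c by simp
        then have "perp v (block s x 0)"
          using perp_scale_iff[OF \<open>c \<noteq> 0\<close>] perp_commute by metis
        then show False using line supported_block[OF k0] \<open>\<not> Q x\<close> unfolding Q_def by blast
      qed
      then show "block s x t = (\<lambda>i. \<gamma> t * block s x 0 i)" using c by simp
    qed
  qed
  have P_linear: "P (\<lambda>i. x i + c * y i)" if "P x" "P y" for x y c
    unfolding P_def block_linear
  proof (intro allI impI)
    fix t assume "t < k"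
    then have "block s x t i = \<gamma> t * block s x 0 i" "block s y t i = \<gamma> t * block s y 0 i" for i
      using that unfolding P_def by meson+
    then show "(\<lambda>i. block s x t i + c * block s y t i) =
        (\<lambda>i. \<gamma> t * (block s x 0 i + c * block s y 0 i))"
      by (intro ext) (simp only: distrib_left mult.left_commute)
  qed
  have Q_linear: "Q (\<lambda>i. x i + c * y i)" if Q: "Q x" "Q y" for x y c
  proof -
    obtain p where p: "block s x 0 = (\<lambda>i. p * v i)" using Q(1) unfolding Q_def ..
    obtain q where q: "block s y 0 = (\<lambda>i. q * v i)" using Q(2) unfolding Q_def ..
    from p q have "block s (\<lambda>i. x i + c * y i) 0 = (\<lambda>i. (p + c * q) * v i)"
      unfolding block_linear by (intro ext) (simp add: algebra_simps)
    then show ?thesis unfolding Q_def by blast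
  qed
  have "P x" for x
  proof (rule ccontr)
    assume nP: "\<not> P x"
    have "Q y" for y
    proof (rule ccontr)
      assume nQ: "\<not> Q y"
      then have "P y" "Q x" using PQ nP by blast+
      \<comment> \<open>The sum of an element outside P and one outside Q would lie in
        neither.\<close>
      define z where "z = (\<lambda>i. x i + 1 * y i)"
      have "x = (\<lambda>i. z i + (- 1) * y i)" "y = (\<lambda>i. z i + (- 1) * x i)" by (auto simp: z_def)
      then have "P z \<Longrightarrow> P x" "Q z \<Longrightarrow> Q y" using P_linear \<open>P y\<close> Q_linear \<open>Q x\<close> by metis+
      then show False using nP nQ PQ by blast
    qed
    then have "\<forall>y. \<forall>t<k. \<exists>c. block s y t = (\<lambda>i. c * v i)"
    proof (intro allI impI)
      fix y t assume "t < k" and Q: "\<And>y. Q y"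
      obtain p where p: "block s y 0 = (\<lambda>i. p * v i)" using Q[of y] unfolding Q_def ..
      obtain c where "block s y t = (\<lambda>i. \<gamma> t * block s y 0 i + c * v i)" using diff[OF \<open>t < k\<close>] ..
      then have "block s y t = (\<lambda>i. (\<gamma> t * p + c) * v i)" unfolding p by (simp add: algebra_simps)
      then show "\<exists>c. block s y t = (\<lambda>i. c * v i)" by blast
    qed
    then show False using block_not_in_line[OF s] by blast
  qed
  with \<gamma>(2) show ?thesis unfolding P_def by blast
qed

theorem T_structure:
  "\<exists>A B. \<forall>x. \<forall>t<k. \<forall>j. T x t j = (\<Sum>s<k. (\<Sum>i<n. A j i * x s i) * B s t)"
proof -
  obtain r x0 where r: "r < k" and x0: "test_fun (block r x0 0) \<noteq> 0" using ex_good_block by blast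
  obtain \<gamma> where \<gamma>: "\<gamma> 0 = 1" "\<And>x t. t < k \<Longrightarrow> block r x t = (\<lambda>i. \<gamma> t * block r x 0 i)"
    using block_factor[OF r x0] by blast
  have k0: "0 < k" using k_ge by simp
  define a where "a x = block r x 0" for x
  have a_linear: "a (\<lambda>i. x i + c * y i) = (\<lambda>i. a x i + c * a y i)" for x y c
    unfolding a_def block_linear ..
  have \<gamma>a: "block r x t = (\<lambda>i. \<gamma> t * a x i)" if "t < k" for x t unfolding a_def by (rule \<gamma>(2)[OF that])
  have a_supp: "supported (a x)" for x unfolding a_def by (rule supported_block[OF k0])
  have a0: "test_fun (a x0) \<noteq> 0" using x0 by (simp add: a_def)
  \<comment> \<open>More than k, hence more than three, field elements leave room for one besides 0
    and 1.\<close>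
  obtain e :: 'a where e: "e \<noteq> 0" "e \<noteq> 1"
  proof -
    have "\<not> UNIV \<subseteq> {0, 1 :: 'a}"
    proof
      assume sub: "UNIV \<subseteq> {0, 1 :: 'a}"
      then have "finite (UNIV :: 'a set)" using finite_subset by blast
      moreover have "card (UNIV :: 'a set) \<le> card {0, 1 :: 'a}" using sub by (intro card_mono) auto
      ultimately show False using large_field k_ge by auto
    qed
    then show ?thesis using that by blast
  qed
  \<comment> \<open>If \<open>a x\<close> is zero, so is all of \<open>block r x\<close>, whence x
    is constant and every \<open>block s\<close> kills it.\<close>
  have kernel: "block s x t = (\<lambda>_. 0)" if "a x = (\<lambda>_. 0)" for s x t
  proof -
    have "block r x t = (\<lambda>_. 0)" for t
      using \<gamma>a[of t x] block_outside[of t r x] that by (cases "t < k") auto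
    then have "block r x = (\<lambda>_ _. 0)" by blast
    then have const: "x i = x (n - 1)" if "i < n" for i
      using block_kernel[OF r, of x i] that by (cases "i = n - 1") auto
    have "normalize_rows (rank_one (unit_fun s) x) = normalize_rows (\<lambda>_ _. 0)"
    proof (intro ext)
      fix t i
      show "normalize_rows (rank_one (unit_fun s) x) t i = normalize_rows (\<lambda>_ _. 0) t i"
        using const[of i] by (auto simp: normalize_rows_def rank_one_def)
    qed
    then have "block s x = T (\<lambda>_ _. 0)" unfolding block_def using T_normalize_rows by metis
    then show ?thesis unfolding T_zero by simp
  qed
  have along: "\<exists>c. \<forall>x. L x = (\<lambda>i. c * a x i)"
    if "\<And>x y c. L (\<lambda>i. x i + c * y i) = (\<lambda>i. L x i + c * L y i)"
      "\<And>x. a x = (\<lambda>_. 0) \<Longrightarrow> L x = (\<lambda>_. 0)" "\<And>x. supported (L x)" "\<And>x. perp (a x) (L x)" for L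
    using that(1,2) perp_supported[OF that(4) _ a_supp that(3)]
    by (intro pointwise_proportional[of a L e x0, OF a_linear _ e a0]) blast+
  have "\<exists>b. \<forall>t<k. \<forall>x. block s x t = (\<lambda>i. b t * a x i)" if s: "s < k" for s
  proof (cases "s = r")
    case True
    then show ?thesis using \<gamma>a by blast
  next
    case False
    have "\<exists>c. \<forall>x. (\<lambda>i. block s x t i - \<gamma> t * block s x 0 i) = (\<lambda>i. c * a x i)" if t: "t < k" for t
    proof (rule along)
      show "(\<lambda>i. block s (\<lambda>i. x i + c * y i) t i - \<gamma> t * block s (\<lambda>i. x i + c * y i) 0 i) =
          (\<lambda>i. (block s x t i - \<gamma> t * block s x 0 i) + c * (block s y t i - \<gamma> t * block s y 0 i))" for x y c
        unfolding block_linear by (intro ext) (simp add: algebra_simps)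
      show "(\<lambda>i. block s x t i - \<gamma> t * block s x 0 i) = (\<lambda>_. 0)" if "a x = (\<lambda>_. 0)" for x
        using kernel[OF that] by simp
      show "supported (\<lambda>i. block s x t i - \<gamma> t * block s x 0 i)" for x
        using supported_block[OF t, of s x] supported_block[OF k0, of s x] by (simp add: supported_def)
      show "perp (a x) (\<lambda>i. block s x t i - \<gamma> t * block s x 0 i)" for x
        by (rule perp_of_null_sum[OF \<gamma>a \<gamma>(1) t null_block null_block_sum_same_vector])
    qed
    then obtain c where diff:
      "\<And>t x. t < k \<Longrightarrow> (\<lambda>i. block s x t i - \<gamma> t * block s x 0 i) = (\<lambda>i. c t * a x i)"
      by metis
    have c: "block s x t i = \<gamma> t * block s x 0 i + c t * a x i" if "t < k" for x t i
      using fun_cong[OF diff[OF that, of x], of i] by (simp add: algebra_simps)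
    \<comment> \<open>Otherwise slots r and s share the row factor \<gamma>. Then x in slot r plus y
      in slot s always has a rank one image, so it is null, and any two vectors would be
      perpendicular.\<close>
    have "\<exists>t<k. c t \<noteq> 0"
    proof (rule ccontr)
      assume "\<not> ?thesis"
      then have zero: "c t = 0" if "t < k" for t using that by blast
      have c0: "block s x t i = \<gamma> t * block s x 0 i" if "t < k" for x t i
        using c[OF that, of x i] unfolding zero[OF that] by (simp only: mult_zero_left add_0_right)
      have "perp x y" for x y :: "nat \<Rightarrow> 'a"
      proof -
        define z where "z = (\<lambda>t i. rank_one (unit_fun r) x t i + 1 * rank_one (unit_fun s) y t i)"
        have "T z = (\<lambda>t i. block r x t i + 1 * block s y t i)"
          unfolding z_def T_linear block_def ..
        then have "T z t = rank_one \<gamma> (\<lambda>i. a x i + block s y 0 i) t" if "t < k" for t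
          using that by (intro ext) (simp add: \<gamma>a c0[OF that, of y] rank_one_def algebra_simps)
        then have "null z" using null_cong[of "T z"] null_rank_one null_T by blast
        then have "perp (z r) (z s)" using r s False unfolding null_iff by blast
        moreover have "z r = x" "z s = y" using False by (auto simp: z_def rank_one_def)
        ultimately show ?thesis by simp
      qed
      then show False using ex_not_perp[where 'a = 'a] by blast
    qed
    then obtain t where t: "t < k" "c t \<noteq> 0" by blast
    \<comment> \<open>For the chosen t, the vector \<open>c t\<close> times \<open>a x\<close>
      combines columns t and 0 of a null block, so it is perpendicular to column 0.\<close>
    have "\<exists>d. \<forall>x. block s x 0 = (\<lambda>i. d * a x i)"
    proof (rule along)
      show "block s (\<lambda>i. x i + c * y i) 0 = (\<lambda>i. block s x 0 i + c * block s y 0 i)" for x y c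
        unfolding block_linear ..
      show "block s x 0 = (\<lambda>_. 0)" if "a x = (\<lambda>_. 0)" for x by (rule kernel[OF that])
      show "supported (block s x 0)" for x by (rule supported_block[OF k0])
      show "perp (a x) (block s x 0)" for x
      proof -
        have "perp (block s x 0) (block s x t)"
          using null_block[of s x] k0 t perp_self unfolding null_iff by (cases "t = 0") auto
        then have "perp (block s x 0) (\<lambda>i. block s x t i + (- \<gamma> t) * block s x 0 i)"
          by (intro perp_linear perp_self)
        then have "perp (block s x 0) (\<lambda>i. c t * a x i)" by (simp add: c[OF t(1), of x])
        then show ?thesis using perp_scale_iff[OF t(2)] perp_commute by metis
      qed
    qed
    then obtain d where d: "\<And>x. block s x 0 = (\<lambda>i. d * a x i)" by blast
    have main: "block s x t = (\<lambda>i. (\<gamma> t * d + c t) * a x i)" if "t < k" for x t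
    proof
      fix i
      have "block s x t i = \<gamma> t * (d * a x i) + c t * a x i" using c[OF that, of x i] unfolding d .
      then show "block s x t i = (\<gamma> t * d + c t) * a x i" by (simp only: distrib_right mult.assoc)
    qed
    show ?thesis
      by (rule exI[of _ "\<lambda>t. \<gamma> t * d + c t"], intro allI impI) (rule main)
  qed
  then have "\<forall>s. \<exists>b. s < k \<longrightarrow> (\<forall>t<k. \<forall>x. block s x t = (\<lambda>i. b t * a x i))" by simp
  from choice[OF this] obtain B where
    "\<forall>s. s < k \<longrightarrow> (\<forall>t<k. \<forall>x. block s x t = (\<lambda>i. B s t * a x i))" ..
  then have B: "block s x t = (\<lambda>i. B s t * a x i)" if "s < k" "t < k" for s t x
    using that by simp
  have a_expand: "a x j = (\<Sum>i<n. a (unit_fun i) j * x i)" for x j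
  proof -
    have "block r x = block r (\<lambda>j. \<Sum>i<n. x i * unit_fun i j)"
      unfolding block_def
    proof (intro T_cong)
      fix t j assume "j < n"
      have "(\<Sum>i<n. x i * unit_fun i j) = (\<Sum>i<n. if i = j then x j else 0)"
        by (intro sum.cong) auto
      with \<open>j < n\<close> show "rank_one (unit_fun r) x t j =
          rank_one (unit_fun r) (\<lambda>j. \<Sum>i<n. x i * unit_fun i j) t j"
        by (simp add: rank_one_def)
    qed
    then show ?thesis
      unfolding a_def block_sum[OF finite_lessThan] by (simp add: mult.commute)
  qed
  have T_eq: "T x t j = (\<Sum>s<k. (\<Sum>i<n. a (unit_fun i) j * x s i) * B s t)" if t: "t < k" for x t j
  proof -
    have "T x t j = (\<Sum>s<k. block s (x s) t j)" unfolding T_blocks[of x] ..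
    also have "\<dots> = (\<Sum>s<k. (\<Sum>i<n. a (unit_fun i) j * x s i) * B s t)"
    proof (intro sum.cong refl)
      fix s assume "s \<in> {..<k}"
      then have "block s (x s) t j = a (x s) j * B s t" using B[of s t "x s"] t by simp
      then show "block s (x s) t j = (\<Sum>i<n. a (unit_fun i) j * x s i) * B s t"
        unfolding a_expand[of "x s"] .
    qed
    finally show ?thesis .
  qed
  show ?thesis
    by (rule exI[of _ "\<lambda>j i. a (unit_fun i) j"], rule exI[of _ B], intro allI impI) (rule T_eq)
qed

end

section \<open>Cullis determinants of products and selection matrices\<close>

lemma submatrix_mult_rows:
  assumes "X \<in> carrier_mat n k" and "B \<in> carrier_mat k l"
  shows "submatrix (X * B) I UNIV = submatrix X I UNIV * B"
proof (rule eq_matI)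
  fix i j assume "i < dim_row (submatrix X I UNIV * B)" "j < dim_col (submatrix X I UNIV * B)"
  then have ij: "i < card {i. i < n \<and> i \<in> I}" "j < l"
    using assms by (auto simp: dim_submatrix)
  then have "pick I i < n" using pick_le[of i n I] by simp
  with ij assms show "submatrix (X * B) I UNIV $$ (i, j) = (submatrix X I UNIV * B) $$ (i, j)"
    by (auto simp: submatrix_def pick_UNIV scalar_prod_def intro!: sum.cong)
qed (use assms in \<open>auto simp: dim_submatrix\<close>)

lemma cullis_det_mult_right:
  assumes X: "X \<in> carrier_mat n k" and B: "B \<in> carrier_mat k k"
  shows "cullis_det (X * B) = cullis_det X * det B"
proof -
  have "det (submatrix (X * B) I UNIV) = det (submatrix X I UNIV) * det B" if "I \<in> index_sets n k" for I
  proof -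
    have "{i. i < n \<and> i \<in> I} = I" using that by (auto simp: index_sets_def)
    then have "submatrix X I UNIV \<in> carrier_mat k k"
      using that X by (auto simp: dim_submatrix index_sets_def intro!: carrier_matI)
    from det_mult[OF this B] show ?thesis by (simp add: submatrix_mult_rows[OF X B])
  qed
  then show ?thesis
    using X B by (simp add: cullis_det_def sum_distrib_right mult.assoc)
qed

text \<open>The test matrix for the determinant identity: multiplying A by it selects the columns I,
  so the identity becomes preservation of \<open>cullis_det\<close> at this matrix.\<close>

definition selection_mat :: "nat \<Rightarrow> nat set \<Rightarrow> 'a::field mat" where
  "selection_mat n I = mat n (card I) (\<lambda>(i, t). if i = pick I t then 1 else 0)"

lemma mult_selection_mat:
  assumes "A \<in> carrier_mat m n" and "I \<in> index_sets n k"
  shows "A * selection_mat n I = submatrix A UNIV I"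
proof (rule eq_matI)
  have I: "{j. j < n \<and> j \<in> I} = I" using assms(2) by (auto simp: index_sets_def)
  then show "dim_row (A * selection_mat n I) = dim_row (submatrix A UNIV I)"
    "dim_col (A * selection_mat n I) = dim_col (submatrix A UNIV I)"
    using assms(1) by (auto simp: dim_submatrix selection_mat_def)
  fix i j assume "i < dim_row (submatrix A UNIV I)" "j < dim_col (submatrix A UNIV I)"
  then have ij: "i < m" "j < card I" using assms(1) I by (auto simp: dim_submatrix)
  then have p: "pick I j < n" using pick_in_set_le[of j I] assms(2) by (auto simp: index_sets_def)
  have "(A * selection_mat n I) $$ (i, j) = (\<Sum>l\<in>{0..<n}. A $$ (i, l) * (if l = pick I j then 1 else 0))"
    using ij assms(1) by (simp add: selection_mat_def scalar_prod_def)
  also have "\<dots> = (\<Sum>l\<in>{0..<n}. if l = pick I j then A $$ (i, pick I j) else 0)"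
    by (intro sum.cong) auto
  also have "\<dots> = submatrix A UNIV I $$ (i, j)"
    using p ij assms(1) I by (simp add: submatrix_def pick_UNIV)
  finally show "(A * selection_mat n I) $$ (i, j) = submatrix A UNIV I $$ (i, j)" .
qed

text \<open>A set J other than I of the same size contains a row outside I; this row is zero, so
  only the minor at I survives, and it is the identity.\<close>

lemma cullis_det_selection_mat:
  assumes I: "I \<in> index_sets n k"
  shows "cullis_det (selection_mat n I) = (index_sign I :: 'a::field)"
proof -
  let ?E = "selection_mat n I :: 'a mat"
  have card: "card I = k" and E: "?E \<in> carrier_mat n k"
    using I by (auto simp: index_sets_def selection_mat_def)
  have dims: "{i. i < n \<and> i \<in> J} = J" if "J \<in> index_sets n k" for J
    using that by (auto simp: index_sets_def)
  have self: "submatrix ?E I UNIV = 1\<^sub>m k"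
  proof (rule eq_matI)
    fix i j assume ij: "i < dim_row (1\<^sub>m k :: 'a mat)" "j < dim_col (1\<^sub>m k :: 'a mat)"
    then have "pick I i < n" using pick_in_set_le[of i I] I card by (auto simp: index_sets_def)
    moreover have "pick I i = pick I j \<longleftrightarrow> i = j"
      using ij card pick_mono_le[of i I j] pick_mono_le[of j I i] by (cases i j rule: linorder_cases) auto
    ultimately show "submatrix ?E I UNIV $$ (i, j) = 1\<^sub>m k $$ (i, j)"
      using ij card E dims[OF I] by (simp add: submatrix_def pick_UNIV selection_mat_def)
  qed (use E card dims[OF I] in \<open>auto simp: dim_submatrix\<close>)
  have other: "det (submatrix ?E J UNIV) = 0" if J: "J \<in> index_sets n k" and "J \<noteq> I" for J
  proof -
    have fin: "finite I" "finite J" using I J finite_subset[of _ "{..<n}"] by (auto simp: index_sets_def)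
    have "\<not> J \<subseteq> I" using card_subset_eq[OF fin(1), of J] that card by (auto simp: index_sets_def)
    then obtain a where a: "a \<in> J" "a \<notin> I" by blast
    define p where "p = card {b \<in> J. b < a}"
    have "{b \<in> J. b < a} \<subset> J" using a by auto
    then have p: "p < k" using psubset_card_mono[OF fin(2)] J by (auto simp: p_def index_sets_def)
    have pick: "pick J p = a" unfolding p_def using a(1) by (rule pick_card_in_set)
    have "a < n" using a J by (auto simp: index_sets_def)
    let ?S = "submatrix ?E J UNIV"
    have S: "?S \<in> carrier_mat k k"
      using E dims[OF J] J by (auto simp: dim_submatrix index_sets_def intro!: carrier_matI)
    have "?S $$ (p, t) = 0" if t: "t < k" for t
    proof -
      have "pick I t \<in> I" using t card by (intro pick_in_set_le) simp
      then have "a \<noteq> pick I t" using a by blast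
      then show ?thesis using p t E dims[OF J] J pick \<open>a < n\<close> card
        by (simp add: submatrix_def pick_UNIV selection_mat_def index_sets_def)
    qed
    then show ?thesis using laplace_expansion_row[OF S p] by simp
  qed
  have "cullis_det ?E = (\<Sum>J\<in>index_sets n k. if J = I then index_sign I else 0)"
    unfolding cullis_det_def using E self other by (intro sum.cong) auto
  then show ?thesis using I by simp
qed

section \<open>Return to matrices\<close>

context cullis_form
begin

lemma equal_rows_iff:
  assumes "X \<in> carrier_mat n k" and "Y \<in> carrier_mat n k"
  shows "X - Y \<in> equal_rows n k \<longleftrightarrow> normalize_rows (col_fun X) = normalize_rows (col_fun Y)"
proof
  assume *: "X - Y \<in> equal_rows n k"
  show "normalize_rows (col_fun X) = normalize_rows (col_fun Y)"
  proof (intro ext)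
    fix t i
    show "normalize_rows (col_fun X) t i = normalize_rows (col_fun Y) t i"
    proof (cases "t < k \<and> i < n - 1")
      case True
      then have "i < n" "n - 1 < n" by auto
      with * have "row (X - Y) i = row (X - Y) (n - 1)" unfolding equal_rows_def by blast
      then have "row (X - Y) i $ t = row (X - Y) (n - 1) $ t" by (rule arg_cong)
      then have "X $$ (i, t) - Y $$ (i, t) = X $$ (n - 1, t) - Y $$ (n - 1, t)"
        using True assms \<open>i < n\<close> \<open>n - 1 < n\<close> by simp
      with True show ?thesis by (simp add: normalize_rows_def col_fun_def algebra_simps)
    qed (auto simp: normalize_rows_def)
  qed
next
  assume eq: "normalize_rows (col_fun X) = normalize_rows (col_fun Y)"
  have last: "X $$ (i, t) - Y $$ (i, t) = X $$ (n - 1, t) - Y $$ (n - 1, t)" if "i < n" "t < k" for i t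
  proof (cases "i = n - 1")
    case False
    with that have "i < n - 1" by simp
    with that show ?thesis using fun_cong[OF fun_cong[OF eq, of t], of i]
      by (simp add: normalize_rows_def col_fun_def algebra_simps)
  qed simp
  have "row (X - Y) i = row (X - Y) j" if "i < n" "j < n" for i j
    using that assms last[OF that(1)] last[OF that(2)] by (intro eq_vecI) auto
  moreover have "X - Y \<in> carrier_mat n k" by (rule minus_carrier_mat[OF assms(2)])
  ultimately show "X - Y \<in> equal_rows n k" unfolding equal_rows_def by blast
qed

end

theorem theorem6p27:
  fixes \<phi> \<psi> :: "'a::field mat \<Rightarrow> 'a mat" and n k :: nat
  assumes "k \<ge> 3" and "n \<ge> k + 2" and "odd (n + k)"
    and "infinite (UNIV :: 'a set) \<or> card (UNIV :: 'a set) > k"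
    and "\<phi> \<in> carrier_mat n k \<rightarrow> carrier_mat n k"
    and "\<psi> \<in> carrier_mat n k \<rightarrow> carrier_mat n k"
    and "\<And>X Y c. X \<in> carrier_mat n k \<Longrightarrow> Y \<in> carrier_mat n k \<Longrightarrow>
      cullis_det (X + c \<cdot>\<^sub>m Y) = cullis_det (\<phi> X + c \<cdot>\<^sub>m \<psi> Y)"
  shows "\<exists>A \<in> carrier_mat n n. \<exists>B \<in> carrier_mat k k.
    (\<forall>I\<in>index_sets n k. cullis_det (submatrix A UNIV I) * det B = index_sign I) \<and>
    (\<forall>X\<in>carrier_mat n k. \<phi> X - \<psi> X \<in> equal_rows n k \<and> \<psi> X - A * X * B \<in> equal_rows n k)"
proof -
  interpret cullis_form n k using assms(1-3) by unfold_locales auto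
  \<comment> \<open>The locale works with total functions of column and row, so M transposes the
    arguments and discards entries out of range, which \<omega> ignores.\<close>
  define M where "M x = mat n k (\<lambda>(i, t). x t i)" for x :: "nat \<Rightarrow> nat \<Rightarrow> 'a"
  have M [simp]: "M x \<in> carrier_mat n k" for x by (simp add: M_def)
  have M_col_fun: "M (col_fun X) = X" if "X \<in> carrier_mat n k" for X
    using that by (intro eq_matI) (auto simp: M_def col_fun_def)
  have col_fun_M: "col_fun (M x) t i = x t i" if "t < k" "i < n" for x t i
    using that by (simp add: M_def col_fun_def)
  have \<phi>: "\<phi> X \<in> carrier_mat n k" and \<psi>: "\<psi> X \<in> carrier_mat n k" if "X \<in> carrier_mat n k" for X
    using assms(5,6) that by auto
  have cullis_det_eq_iff: "cullis_det X = cullis_det Y \<longleftrightarrow> \<omega> (col_fun X) = \<omega> (col_fun Y)"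
    if "X \<in> carrier_mat n k" "Y \<in> carrier_mat n k" for X Y :: "'a mat"
    using that by (simp add: cullis_det_eq_\<omega>)
  interpret cullis_pair n k "\<lambda>x. col_fun (\<phi> (M x))" "\<lambda>x. col_fun (\<psi> (M x))"
  proof
    show "infinite (UNIV :: 'a set) \<or> card (UNIV :: 'a set) > k" by (rule assms(4))
    fix x z c
    have "\<omega> (\<lambda>t i. x t i + c * z t i) = \<omega> (col_fun (M x + c \<cdot>\<^sub>m M z))"
      by (intro \<omega>_cong) (simp add: M_def col_fun_def)
    also have "\<dots> = \<omega> (col_fun (\<phi> (M x) + c \<cdot>\<^sub>m \<psi> (M z)))"
      using assms(7)[of "M x" "M z" c] \<phi>[OF M] \<psi>[OF M] by (subst cullis_det_eq_iff[symmetric]) auto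
    also have "\<dots> = \<omega> (\<lambda>t i. col_fun (\<phi> (M x)) t i + c * col_fun (\<psi> (M z)) t i)"
      using \<phi>[OF M, of x] \<psi>[OF M, of z] by (intro \<omega>_cong) (simp add: col_fun_def)
    finally show "\<omega> (\<lambda>t i. x t i + c * z t i) =
        \<omega> (\<lambda>t i. col_fun (\<phi> (M x)) t i + c * col_fun (\<psi> (M z)) t i)" .
  qed
  obtain a b where ab: "\<And>x t j. t < k \<Longrightarrow> T x t j = (\<Sum>s<k. (\<Sum>i<n. a j i * x s i) * b s t)"
    using T_structure by blast
  define A where "A = mat n n (\<lambda>(j, i). a j i)"
  define B where "B = mat k k (\<lambda>(s, t). b s t)"
  have A: "A \<in> carrier_mat n n" and B: "B \<in> carrier_mat k k" by (auto simp: A_def B_def)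
  have mult_index: "(C * D) $$ (j, t) = (\<Sum>s<k. C $$ (j, s) * D $$ (s, t))"
    if "C \<in> carrier_mat n k" "D \<in> carrier_mat k k" "j < n" "t < k" for C D :: "'a mat" and j t
    using that by (simp add: scalar_prod_def atLeast0LessThan)
  have T_eq: "T (col_fun X) = normalize_rows (col_fun (A * X * B))" if X: "X \<in> carrier_mat n k" for X
  proof -
    have AX: "(A * X) $$ (j, s) = (\<Sum>i<n. a j i * X $$ (i, s))" if "j < n" "s < k" for j s
      using that X by (simp add: A_def scalar_prod_def atLeast0LessThan)
    have "T (col_fun X) t j = col_fun (A * X * B) t j" if "t < k" "j < n" for t j
    proof -
      have "(A * X * B) $$ (j, t) = (\<Sum>s<k. (A * X) $$ (j, s) * B $$ (s, t))"
        using that mult_carrier_mat[OF A X] B by (intro mult_index)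
      also have "\<dots> = (\<Sum>s<k. (\<Sum>i<n. a j i * X $$ (i, s)) * b s t)"
        using that AX by (intro sum.cong) (auto simp: B_def)
      finally show ?thesis using ab[OF that(1)] by (simp add: col_fun_def)
    qed
    then have "normalize_rows (T (col_fun X)) = normalize_rows (col_fun (A * X * B))"
      unfolding normalize_rows_def using n_ge by (intro ext) auto
    then show ?thesis by simp
  qed
  have \<psi>_mod: "\<psi> X - A * X * B \<in> equal_rows n k" if X: "X \<in> carrier_mat n k" for X
    using T_eq[OF X] equal_rows_iff[OF \<psi>[OF X], of "A * X * B"] X A B
    by (simp add: T_def M_col_fun)
  have \<phi>_mod: "\<phi> X - \<psi> X \<in> equal_rows n k" if X: "X \<in> carrier_mat n k" for X
    using normalize_rows_f[of "col_fun X"] equal_rows_iff[OF \<phi>[OF X] \<psi>[OF X]] X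
    by (simp add: T_def M_col_fun)
  have "cullis_det (submatrix A UNIV I) * det B = index_sign I" if I: "I \<in> index_sets n k" for I
  proof -
    let ?E = "selection_mat n I :: 'a mat"
    have E: "?E \<in> carrier_mat n k" using I by (auto simp: selection_mat_def index_sets_def)
    have "cullis_det (submatrix A UNIV I) * det B = cullis_det (A * ?E) * det B"
      unfolding mult_selection_mat[OF A I] ..
    also have "\<dots> = cullis_det (A * ?E * B)"
      using A E B by (intro cullis_det_mult_right[symmetric]) auto
    also have "\<dots> = cullis_det ?E"
    proof (subst cullis_det_eq_iff)
      have "\<omega> (col_fun (A * ?E * B)) = \<omega> (T (col_fun ?E))" unfolding T_eq[OF E] by simp
      also have "\<dots> = \<omega> (col_fun ?E)" unfolding T_def by (simp add: \<omega>_preserve)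
      finally show "\<omega> (col_fun (A * ?E * B)) = \<omega> (col_fun ?E)" .
    qed (use A E B in auto)
    also have "\<dots> = index_sign I" by (rule cullis_det_selection_mat[OF I])
    finally show ?thesis .
  qed
  with A B \<psi>_mod \<phi>_mod show ?thesis by blast
qed

end
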